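(* There is a randomized distributed algorithm (called Wireless\_DFS) that, in the bare-bones SINR model with weak sensitivity and weak connectivity and from an uncoordinated start with a single source, accomplishes broadcast of the source's rumor (so every node receives the rumor and is awoken) in $O(n\log^2 N)$ rounds with high probability. The total number of random bits used per node is $O(\log^3 N)$.
   Context: Model: $n$ nodes located in the Euclidean plane, each with a unique name in $\{1,\dots,N\}$, $N\ge n$. Synchronous rounds; in each round a node transmits or listens; no collision detection. Uniform transmission power $P$; constants $\alpha>2$, $\mathcal{N}>0$, $\beta\ge1$, $\varepsilon\in(0,1)$; $r=(P/(\mathcal{N}\beta))^{1/\alpha}$. If the set $\mathcal{T}$ transmits in a round, then $u\notin\mathcal{T}$ receives the message of $v\in\mathcal{T}$ iff $\frac{P\,\mathrm{dist}(v,u)^{-\alpha}}{\mathcal{N}+\sum_{w\in\mathcal{T}\setminus\{v\}}P\,\mathrm{dist}(w,u)^{-\alpha}}\ge\beta$ and $\mathrm{dist}(v,u)\le(1-\varepsilon)r$ (weak sensitivity). The communication graph $G$ joins $u,v$ iff $\mathrm{dist}(u,v)\le(1-\varepsilon)r$ (weak connectivity); $G$ is assumed connected; $\Delta$ is its maximum degree. Bare-bones: nodes know only their own name, $N$ and $\Delta$ (not $n$, their positions, or their neighbors); each message carries at most one rumor plus $O(\log N)$ control bits. Uncoordinated start: only the source is awake at the beginning; any other node becomes awake (and may begin participating) only upon first receiving a message. "With high probability" means with probability at least $1-n^{-d}$ for a sufficiently large constant $d\ge1$. *)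

theory Defs
  imports "HOL-Analysis.Analysis" "HOL-Probability.Probability"
begin

section \<open>SINR model parameters\<close>

record sinr =
  s_P     :: real   \<comment> \<open>uniform transmission power P\<close>
  s_alpha :: real   \<comment> \<open>path-loss exponent alpha\<close>
  s_noise :: real   \<comment> \<open>ambient noise\<close>
  s_beta  :: real   \<comment> \<open>SINR threshold beta\<close>
  s_eps   :: real   \<comment> \<open>sensitivity parameter epsilon\<close>

definition sinr_ok :: "sinr \<Rightarrow> bool" where
  "sinr_ok S \<longleftrightarrow> s_P S > 0 \<and> s_alpha S > 2 \<and> s_noise S > 0 \<and> s_beta S \<ge> 1
      \<and> 0 < s_eps S \<and> s_eps S < 1"

text \<open>r = (P / (N beta))^(1/alpha)\<close>
definition sinr_range :: "sinr \<Rightarrow> real" where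
  "sinr_range S = (s_P S / (s_noise S * s_beta S)) powr (1 / s_alpha S)"

type_synonym position = "real ^ 2"

text \<open>Node u (not transmitting) receives the message of transmitter v when the set T transmits
  (SINR condition plus weak sensitivity).\<close>
definition sinr_receives ::
  "sinr \<Rightarrow> (nat \<Rightarrow> position) \<Rightarrow> nat set \<Rightarrow> nat \<Rightarrow> nat \<Rightarrow> bool" where
  "sinr_receives S pos T v u \<longleftrightarrow>
     v \<in> T \<and> u \<notin> T \<and>
     s_P S * dist (pos v) (pos u) powr (- s_alpha S)
       / (s_noise S + (\<Sum>w\<in>T - {v}. s_P S * dist (pos w) (pos u) powr (- s_alpha S)))
       \<ge> s_beta S \<and>
     dist (pos v) (pos u) \<le> (1 - s_eps S) * sinr_range S"

section \<open>Communication graph (weak connectivity)\<close>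

definition comm_adj :: "sinr \<Rightarrow> nat set \<Rightarrow> (nat \<Rightarrow> position) \<Rightarrow> nat \<Rightarrow> nat \<Rightarrow> bool" where
  "comm_adj S V pos u v \<longleftrightarrow> u \<in> V \<and> v \<in> V \<and> u \<noteq> v \<and>
      dist (pos u) (pos v) \<le> (1 - s_eps S) * sinr_range S"

definition comm_connected :: "sinr \<Rightarrow> nat set \<Rightarrow> (nat \<Rightarrow> position) \<Rightarrow> bool" where
  "comm_connected S V pos \<longleftrightarrow>
     (\<forall>u\<in>V. \<forall>v\<in>V. (u, v) \<in> {(x, y). comm_adj S V pos x y}\<^sup>*)"

definition max_degree :: "sinr \<Rightarrow> nat set \<Rightarrow> (nat \<Rightarrow> position) \<Rightarrow> nat" where
  "max_degree S V pos = Max ((\<lambda>u. card {v. comm_adj S V pos u v}) ` V)"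

text \<open>A network: n = card V nodes with distinct names in {1..N}, distinct positions in the plane,
  a source, and a connected communication graph.\<close>
definition valid_network ::
  "sinr \<Rightarrow> nat \<Rightarrow> nat set \<Rightarrow> (nat \<Rightarrow> position) \<Rightarrow> nat \<Rightarrow> bool" where
  "valid_network S N V pos src \<longleftrightarrow>
     V \<subseteq> {1..N} \<and> src \<in> V \<and> inj_on pos V \<and> comm_connected S V pos"

section \<open>Bare-bones randomized distributed algorithms\<close>

text \<open>A message: a flag saying whether the (single) rumor is attached, plus control bits.\<close>
type_synonym msg = "bool \<times> bool list"

text \<open>A node's local algorithm. The initial state depends only on N, Delta, the node's own name,
  whether it is the source, and the node's private random bit string (of length
  \<open>a_nbits N Delta\<close>; these are all random bits the node ever uses). In each round an awake node
  either transmits (\<open>Some m\<close>) or listens (\<open>None\<close>), and then updates its state with what it heard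
  (\<open>None\<close> if it transmitted or heard nothing).\<close>
record 's dalg =
  a_init  :: "nat \<Rightarrow> nat \<Rightarrow> nat \<Rightarrow> bool \<Rightarrow> bool list \<Rightarrow> 's"
  a_act   :: "'s \<Rightarrow> msg option"
  a_upd   :: "'s \<Rightarrow> msg option \<Rightarrow> 's"
  a_nbits :: "nat \<Rightarrow> nat \<Rightarrow> nat"

record 's nstate =
  n_awake :: bool
  n_st    :: 's
  n_knows :: bool   \<comment> \<open>node has received (or originated) the rumor\<close>

definition out_msg :: "'s dalg \<Rightarrow> 's nstate \<Rightarrow> msg" where
  "out_msg A c = (case a_act A (n_st c) of
       Some (b, ctl) \<Rightarrow> (b \<and> n_knows c, ctl)
     | None \<Rightarrow> (False, []))"

definition transmitters :: "'s dalg \<Rightarrow> nat set \<Rightarrow> (nat \<Rightarrow> 's nstate) \<Rightarrow> nat set" where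
  "transmitters A V c = {v \<in> V. n_awake (c v) \<and> a_act A (n_st (c v)) \<noteq> None}"

definition received ::
  "sinr \<Rightarrow> 's dalg \<Rightarrow> nat set \<Rightarrow> (nat \<Rightarrow> position) \<Rightarrow> (nat \<Rightarrow> 's nstate) \<Rightarrow> nat \<Rightarrow> msg option" where
  "received S A V pos c u =
     (let T = transmitters A V c in
      if \<exists>v. sinr_receives S pos T v u
      then Some (out_msg A (c (SOME v. sinr_receives S pos T v u)))
      else None)"

definition step ::
  "sinr \<Rightarrow> 's dalg \<Rightarrow> nat set \<Rightarrow> (nat \<Rightarrow> position) \<Rightarrow> (nat \<Rightarrow> 's nstate) \<Rightarrow> (nat \<Rightarrow> 's nstate)" where
  "step S A V pos c = (\<lambda>u.
     if u \<notin> V then c u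
     else if u \<in> transmitters A V c then c u\<lparr>n_st := a_upd A (n_st (c u)) None\<rparr>
     else (let r = received S A V pos c u in
           if n_awake (c u) \<or> r \<noteq> None
           then \<lparr>n_awake = True, n_st = a_upd A (n_st (c u)) r,
                 n_knows = (n_knows (c u) \<or> (\<exists>ctl. r = Some (True, ctl)))\<rparr>
           else c u))"

text \<open>Uncoordinated start: only the source is awake (and knows the rumor) initially.
  \<open>run \<dots> t\<close> is the configuration after t rounds.\<close>
primrec run ::
  "sinr \<Rightarrow> 's dalg \<Rightarrow> nat \<Rightarrow> nat \<Rightarrow> nat set \<Rightarrow> (nat \<Rightarrow> position) \<Rightarrow> nat
   \<Rightarrow> (nat \<Rightarrow> bool list) \<Rightarrow> nat \<Rightarrow> (nat \<Rightarrow> 's nstate)" where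
  "run S A N D V pos src bits 0 =
     (\<lambda>v. \<lparr>n_awake = (v = src), n_st = a_init A N D v (v = src) (bits v), n_knows = (v = src)\<rparr>)"
| "run S A N D V pos src bits (Suc t) = step S A V pos (run S A N D V pos src bits t)"

definition broadcast_done ::
  "sinr \<Rightarrow> 's dalg \<Rightarrow> nat \<Rightarrow> nat \<Rightarrow> nat set \<Rightarrow> (nat \<Rightarrow> position) \<Rightarrow> nat
   \<Rightarrow> (nat \<Rightarrow> bool list) \<Rightarrow> nat \<Rightarrow> bool" where
  "broadcast_done S A N D V pos src bits t \<longleftrightarrow>
     (\<forall>v\<in>V. n_awake (run S A N D V pos src bits t v) \<and> n_knows (run S A N D V pos src bits t v))"

text \<open>Distribution of the nodes' private random bits: independent uniform strings.\<close>
definition random_bits :: "'s dalg \<Rightarrow> nat \<Rightarrow> nat \<Rightarrow> nat set \<Rightarrow> (nat \<Rightarrow> bool list) pmf" where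
  "random_bits A N D V = Pi_pmf V [] (\<lambda>_. pmf_of_set {xs. length xs = a_nbits A N D})"

text \<open>Every transmitted message carries at most \<open>cm * log N\<close> control bits, in every execution.\<close>
definition msg_size_ok ::
  "sinr \<Rightarrow> 's dalg \<Rightarrow> real \<Rightarrow> nat \<Rightarrow> nat set \<Rightarrow> (nat \<Rightarrow> position) \<Rightarrow> nat \<Rightarrow> bool" where
  "msg_size_ok S A cm N V pos src \<longleftrightarrow>
     (\<forall>bits. (\<forall>v\<in>V. length (bits v) = a_nbits A N (max_degree S V pos)) \<longrightarrow>
       (\<forall>t. \<forall>v\<in>V. \<forall>b ctl.
          n_awake (run S A N (max_degree S V pos) V pos src bits t v) \<and>
          a_act A (n_st (run S A N (max_degree S V pos) V pos src bits t v)) = Some (b, ctl)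
          \<longrightarrow> real (length ctl) \<le> cm * log 2 (real N + 1)))"

end

(* A token performs a depth-first traversal. Its holder elects one unvisited neighbour at a time:
   it broadcasts random affine constraints over GF(2), and the unvisited neighbours that satisfy all
   constraints of the current trial answer. Each constraint halves the contenders with pairwise
   independence, so a trial of O(log N) constraints leaves a single contender at some point with
   constant probability (Valiant-Vazirani), and O(log N) trials fail with probability N^(-Omega(d)).
   A lone transmitter is always heard within range, and any contender heard earlier by capture is
   elected just as well, so interference never has to be analysed.

   The contender sets depend on earlier random choices, so each election with contenders needs fresh
   bits. Every node owns two blocks of O(log^3 N) bits: one for its first election, and one that it
   sends, row by row, to its parent after returning the token, for the parent's next election.
   There are at most 2n - 1 elections of O(log^2 N) rounds each, and a union bound over the 2n blocks
   controls the failure probability. *)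

theory Submission
  imports Defs
begin

section \<open>Isolating a contender with random parity constraints\<close>

text \<open>Without collision detection, silence after every row may mean that no unvisited
  neighbour is left or that isolation failed. The holder returns the token in both cases, so the
  only error to control is an election that ends without result although it had contenders. A holder
  with many children runs far more elections than its own block serves; but each election after its
  first follows the return of a child, so it can be charged to that child's supply. The obstacle is
  adaptivity: which block an election reads, and which set contends, are determined by earlier bits.
  Hence the traversal is modelled as a deterministic function of an arbitrary assignment of blocks.
  Changing one block does not change the run up to its only reading, so over that block alone the
  contenders form a fixed set and the isolation bound applies; averaging over the other bits is
  plain counting of bit strings. Separately, the radio rounds are shown to carry out this function
  for every choice of bits.\<close>

definition bit_strings :: "nat \<Rightarrow> bool list set" where
  "bit_strings n = {xs. length xs = n}"

lemma finite_bit_strings [simp]: "finite (bit_strings n)"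
  using finite_lists_length_eq[of "UNIV :: bool set" n] by (simp add: bit_strings_def)

lemma card_bit_strings [simp]: "card (bit_strings n) = 2 ^ n"
  using card_lists_length_eq[of "UNIV :: bool set" n] by (simp add: bit_strings_def)

text \<open>Independence of disjoint segments of a uniform string, in the form of a product of
  counts.\<close>

lemma card_bit_strings_append:
  "card {xs \<in> bit_strings (a + b). P (take a xs) \<and> Q (drop a xs)}
     = card {xs \<in> bit_strings a. P xs} * card {xs \<in> bit_strings b. Q xs}"
proof -
  have "bij_betw (\<lambda>(x, y). x @ y) ({xs \<in> bit_strings a. P xs} \<times> {xs \<in> bit_strings b. Q xs})
          {xs \<in> bit_strings (a + b). P (take a xs) \<and> Q (drop a xs)}"
    by (rule bij_betw_byWitness[where f' = "\<lambda>xs. (take a xs, drop a xs)"])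
       (auto simp: bit_strings_def)
  from bij_betw_same_card[OF this] show ?thesis
    by (simp add: card_cartesian_product)
qed

lemma card_bit_strings_Suc:
  "card {xs \<in> bit_strings (Suc n). P xs}
     = card {xs \<in> bit_strings n. P (True # xs)} + card {xs \<in> bit_strings n. P (False # xs)}"
proof -
  have *: "{xs \<in> bit_strings (Suc n). P xs} = (Cons True) ` {xs \<in> bit_strings n. P (True # xs)}
      \<union> (Cons False) ` {xs \<in> bit_strings n. P (False # xs)}"
  proof (rule set_eqI)
    fix xs :: "bool list"
    show "xs \<in> {xs \<in> bit_strings (Suc n). P xs} \<longleftrightarrow> xs \<in> (Cons True) ` {xs \<in> bit_strings n. P (True # xs)}
      \<union> (Cons False) ` {xs \<in> bit_strings n. P (False # xs)}"
      by (cases xs; cases "hd xs") (auto simp: bit_strings_def image_iff)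
  qed
  show ?thesis
    unfolding * by (subst card_Un_disjoint) (auto simp: card_image inj_on_def)
qed

lemma card_bit_strings_compl:
  "card {xs \<in> bit_strings n. \<not> P xs} + card {xs \<in> bit_strings n. P xs} = 2 ^ n"
proof -
  have "{xs \<in> bit_strings n. \<not> P xs} \<union> {xs \<in> bit_strings n. P xs} = bit_strings n" by auto
  then show ?thesis
    by (subst card_Un_disjoint[symmetric]) auto
qed

text \<open>The inner product over GF(2) of a bit string with the binary digits of a number.\<close>

primrec parity :: "bool list \<Rightarrow> nat \<Rightarrow> bool" where
  "parity [] u \<longleftrightarrow> False"
| "parity (x # w) u \<longleftrightarrow> (x \<and> odd u) \<noteq> parity w (u div 2)"

text \<open>A row is an affine constraint over GF(2): its head is the right-hand side.\<close>

definition survives :: "bool list \<Rightarrow> nat \<Rightarrow> bool" where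
  "survives r u \<longleftrightarrow> hd r = parity (tl r) u"

text \<open>Where the lowest digits of \<open>u\<close> and \<open>v\<close> differ, flipping the
  head coefficient toggles the equation; where they agree, they cancel and the induction moves to
  the halves.\<close>

lemma card_parity_eq:
  "u \<noteq> v \<Longrightarrow> u < 2 ^ k \<Longrightarrow> v < 2 ^ k \<Longrightarrow> 2 * card {w \<in> bit_strings k. parity w u = parity w v} = 2 ^ k"
proof (induction k arbitrary: u v)
  case (Suc k)
  show ?case
  proof (cases "odd u = odd v")
    case True
    then have "u div 2 \<noteq> v div 2"
      using Suc.prems(1) by (metis bit_eq_rec)
    then show ?thesis
      using Suc.IH[of "u div 2" "v div 2"] Suc.prems True
      by (simp add: card_bit_strings_Suc) (cases "even u"; simp)
  next
    case False
    then have "{w \<in> bit_strings k. parity (True # w) u = parity (True # w) v}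
        = {w \<in> bit_strings k. parity (False # w) u \<noteq> parity (False # w) v}"
      by auto
    then show ?thesis
      using card_bit_strings_compl[of k "\<lambda>w. parity (False # w) u = parity (False # w) v"]
      by (simp add: card_bit_strings_Suc)
  qed
qed simp

lemma card_survives: "card {r \<in> bit_strings (Suc k). survives r u} = 2 ^ k"
  using card_bit_strings_compl[of k "\<lambda>w. parity w u"] by (simp add: card_bit_strings_Suc survives_def)

text \<open>Both survive iff their parities agree, which holds for half of the coefficient strings,
  and the right-hand side takes that common value. This is probability 1/4, the product of the two
  marginals.\<close>

lemma card_survives2:
  assumes "u \<noteq> v" "u < 2 ^ k" "v < 2 ^ k"
  shows "2 * card {r \<in> bit_strings (Suc k). survives r u \<and> survives r v} = 2 ^ k"
proof -
  have "card {w \<in> bit_strings k. parity w u \<and> parity w v} + card {w \<in> bit_strings k. \<not> parity w u \<and> \<not> parity w v}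
      = card {w \<in> bit_strings k. parity w u = parity w v}"
    by (subst card_Un_disjoint[symmetric]) (auto intro: arg_cong[where f = card])
  then show ?thesis
    using card_parity_eq[OF assms] by (simp add: card_bit_strings_Suc survives_def)
qed

primrec rows :: "nat \<Rightarrow> nat \<Rightarrow> bool list \<Rightarrow> bool list list" where
  "rows W 0 xs = []"
| "rows W (Suc j) xs = take W xs # rows W j (drop W xs)"

lemma length_rows [simp]: "length (rows W j xs) = j"
  by (induction j arbitrary: xs) auto

lemma rows_take: "j * W \<le> m \<Longrightarrow> rows W j (take m xs) = rows W j xs"
proof (induction j arbitrary: m xs)
  case (Suc j)
  have "drop W (take m xs) = take (m - W) (drop W xs)" by (simp add: drop_take)
  moreover have "j * W \<le> m - W" using Suc.prems by simp
  ultimately show ?case using Suc by (simp add: min_def)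
qed simp

lemma take_rows: "j \<le> J \<Longrightarrow> take j (rows W J xs) = rows W j xs"
proof (induction j arbitrary: J xs)
  case (Suc j)
  then show ?case by (cases J) auto
qed simp

lemma rows_length: "j * W \<le> length xs \<Longrightarrow> r \<in> set (rows W j xs) \<Longrightarrow> length r = W"
proof (induction j arbitrary: xs)
  case (Suc j)
  have "j * W \<le> length (drop W xs)" using Suc.prems(1) by simp
  then show ?case using Suc.IH[of "drop W xs"] Suc.prems by auto
qed simp

lemma card_rows_all:
  "card {xs \<in> bit_strings (j * W). \<forall>r \<in> set (rows W j xs). Q r} = card {r \<in> bit_strings W. Q r} ^ j"
proof (induction j)
  case (Suc j)
  show ?case
    using card_bit_strings_append[of W "j * W" Q "\<lambda>xs. \<forall>r \<in> set (rows W j xs). Q r"] Suc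
    by simp
qed (simp add: bit_strings_def)

lemma card_rows_prefix:
  assumes "j \<le> J"
  shows "card {xs \<in> bit_strings (J * W). \<forall>r \<in> set (rows W j xs). Q r}
    = card {r \<in> bit_strings W. Q r} ^ j * 2 ^ ((J - j) * W)"
proof -
  have e: "J * W = j * W + (J - j) * W"
    using assms by (metis add_mult_distrib le_add_diff_inverse)
  show ?thesis
    using card_bit_strings_append[of "j * W" "(J - j) * W" "\<lambda>xs. \<forall>r \<in> set (rows W j xs). Q r" "\<lambda>_. True"]
    unfolding e[symmetric] by (simp add: rows_take card_rows_all)
qed

text \<open>Only nonempty prefixes count: contenders first transmit after they have heard a
  row.\<close>

primrec isolates :: "nat set \<Rightarrow> bool list list \<Rightarrow> bool" where
  "isolates Y [] \<longleftrightarrow> False"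
| "isolates Y (r # rs) \<longleftrightarrow> card {u \<in> Y. survives r u} = 1 \<or> isolates {u \<in> Y. survives r u} rs"

lemma isolates_prefix:
  "0 < j \<Longrightarrow> j \<le> length rs \<Longrightarrow> card {u \<in> Y. \<forall>r \<in> set (take j rs). survives r u} = 1 \<Longrightarrow> isolates Y rs"
proof (induction rs arbitrary: j Y)
  case (Cons r rs)
  obtain i where i: "j = Suc i" using Cons.prems(1) gr0_implies_Suc by blast
  have e: "{u \<in> Y. \<forall>r \<in> set (take j (r # rs)). survives r u}
      = {u \<in> {u \<in> Y. survives r u}. \<forall>r \<in> set (take i rs). survives r u}"
    using i by auto
  show ?case
  proof (cases "i = 0")
    case True
    then show ?thesis using Cons.prems(3) unfolding e by simp
  next
    case False
    then show ?thesis using Cons.IH[of i "{u \<in> Y. survives r u}"] Cons.prems i e by auto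
  qed
qed simp

text \<open>Equality holds for \<open>s <= 2\<close>, and beyond that the right-hand side is
  negative. The chance of a unique survivor is thus bounded below by two factorial moments, which
  pairwise independence determines.\<close>

lemma indicator_one_ge: "(if s = (1::nat) then 1 else 0 :: real) \<ge> real s - real (s * (s - 1))"
proof (cases "s \<le> 2")
  case True
  then have "s = 0 \<or> s = 1 \<or> s = 2" by auto
  then show ?thesis by auto
next
  case False
  then have "s * 1 \<le> s * (s - 1)" by (intro mult_le_mono) auto
  then have "real s \<le> real (s * (s - 1))" by linarith
  then show ?thesis by simp
qed

lemma sum_card_swap:
  assumes "finite A" "finite B"
  shows "(\<Sum>x\<in>A. real (card {y \<in> B. R x y})) = (\<Sum>y\<in>B. real (card {x \<in> A. R x y}))"
proof -
  have "(\<Sum>x\<in>A. real (card {y \<in> B. R x y})) = (\<Sum>x\<in>A. \<Sum>y\<in>B. if R x y then 1 else 0)"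
    using assms by (intro sum.cong refl) (simp add: sum.If_cases Int_def)
  also have "\<dots> = (\<Sum>y\<in>B. \<Sum>x\<in>A. if R x y then 1 else 0)"
    by (rule sum.swap)
  also have "\<dots> = (\<Sum>y\<in>B. real (card {x \<in> A. R x y}))"
    using assms by (intro sum.cong refl) (simp add: sum.If_cases Int_def)
  finally show ?thesis .
qed

lemma card_offdiag: "finite Y \<Longrightarrow> card {p \<in> Y \<times> Y. fst p \<noteq> snd p} = card Y * (card Y - 1)"
proof -
  assume "finite Y"
  have "{p \<in> Y \<times> Y. fst p \<noteq> snd p} = (SIGMA x:Y. Y - {x})" by auto
  then show ?thesis using \<open>finite Y\<close> by (simp add: card_SigmaI)
qed

lemma card_not_isolates_le:
  assumes X: "finite X" "X \<subseteq> {..<2 ^ k}" "X \<noteq> {}"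
  shows "16 * card {xs \<in> bit_strings (Suc k * Suc k). \<not> isolates X (rows (Suc k) (Suc k) xs)}
    \<le> 13 * 2 ^ (Suc k * Suc k)"
  \<comment> \<open>Valiant--Vazirani: take the prefix length \<open>j\<close> with \<open>|X| / 2^j\<close> in \<open>[1/4, 1/2]\<close>; pairwise
    independence gives \<open>P(exactly one survivor) \<ge> E[s] - E[s(s - 1)] \<ge> 3/16\<close>.\<close>
proof -
  define W where "W = Suc k"
  define n where "n = card X"
  have n0: "n > 0" using X by (simp add: n_def card_gt_0_iff)
  have nk: "n \<le> 2 ^ k"
    using card_mono[OF _ X(2)] by (simp add: n_def)
  define j where "j = (LEAST j. 2 * n \<le> 2 ^ j)"
  \<comment> \<open>The reason for \<open>k + 1\<close> rows in a trial: a set inside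
    \<open>{..<2 ^ k}\<close> never calls for a longer prefix.\<close>
  have exj: "2 * n \<le> 2 ^ W" using nk by (simp add: W_def)
  have j1: "2 * n \<le> 2 ^ j" unfolding j_def by (rule LeastI) (rule exj)
  have jW: "j \<le> W" unfolding j_def by (rule Least_le) (rule exj)
  have jpos: "j > 0" using j1 n0 by (cases j) auto
  have "\<not> 2 * n \<le> 2 ^ (j - 1)"
    unfolding j_def by (rule not_less_Least) (use jpos in \<open>simp add: j_def[symmetric]\<close>)
  then have j2: "2 ^ j < 4 * n" using jpos by (cases j) auto
  define M where "M = W * W"
  define Y where "Y xs = {u \<in> X. \<forall>r \<in> set (rows W j xs). survives r u}" for xs
  have finY: "finite (Y xs)" for xs using X(1) by (simp add: Y_def)
  define y where "y = real n / 2 ^ j"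
  have y: "1 / 4 \<le> y" "y \<le> 1 / 2"
  proof -
    have "real (2 ^ j) \<le> real (4 * n)" "real (2 * n) \<le> real (2 ^ j)"
      using j1 j2 by linarith+
    then show "1 / 4 \<le> y" "y \<le> 1 / 2" by (auto simp: y_def field_simps)
  qed
  have e: "(2::real) ^ M = 2 ^ (j * W) * 2 ^ ((W - j) * W)"
    using jW unfolding M_def
    by (metis add_mult_distrib le_add_diff_inverse power_add)
  have c1: "real (card {xs \<in> bit_strings M. u \<in> Y xs}) = 2 ^ M / 2 ^ j" if "u \<in> X" for u
  proof -
    have "{xs \<in> bit_strings M. u \<in> Y xs} = {xs \<in> bit_strings (W * W). \<forall>r \<in> set (rows W j xs). survives r u}"
      using that by (auto simp: M_def Y_def)
    then have "card {xs \<in> bit_strings M. u \<in> Y xs} = (2 ^ k) ^ j * 2 ^ ((W - j) * W)"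
      using card_rows_prefix[OF jW, of W "\<lambda>r. survives r u"] card_survives[of k u] by (simp add: W_def)
    moreover have "(2::real) ^ (j * W) = (2 ^ k) ^ j * 2 ^ j"
      by (simp add: W_def power_mult[symmetric] power_add[symmetric] algebra_simps)
    ultimately show ?thesis unfolding e by simp
  qed
  have c2: "real (card {xs \<in> bit_strings M. fst p \<in> Y xs \<and> snd p \<in> Y xs}) = 2 ^ M / 4 ^ j"
    if "p \<in> {p \<in> X \<times> X. fst p \<noteq> snd p}" for p
  proof -
    have eq: "2 * card {r \<in> bit_strings W. survives r (fst p) \<and> survives r (snd p)} = 2 ^ k"
      unfolding W_def by (rule card_survives2) (use that X in auto)
    have "{xs \<in> bit_strings M. fst p \<in> Y xs \<and> snd p \<in> Y xs}
        = {xs \<in> bit_strings (W * W). \<forall>r \<in> set (rows W j xs). survives r (fst p) \<and> survives r (snd p)}"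
      using that by (auto simp: M_def Y_def)
    then have c: "card {xs \<in> bit_strings M. fst p \<in> Y xs \<and> snd p \<in> Y xs}
        = card {r \<in> bit_strings W. survives r (fst p) \<and> survives r (snd p)} ^ j * 2 ^ ((W - j) * W)"
      using card_rows_prefix[OF jW, of W "\<lambda>r. survives r (fst p) \<and> survives r (snd p)"] by simp
    have "(2::real) ^ (j * W) = (2 ^ W) ^ j" by (simp add: power_mult[symmetric] mult.commute)
    also have "(2::real) ^ W = 4 * real (card {r \<in> bit_strings W. survives r (fst p) \<and> survives r (snd p)})"
      using arg_cong[OF eq, of real] by (simp add: W_def)
    finally have "(2::real) ^ (j * W)
        = 4 ^ j * real (card {r \<in> bit_strings W. survives r (fst p) \<and> survives r (snd p)}) ^ j"
      by (simp add: power_mult_distrib)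
    then show ?thesis unfolding e c by simp
  qed
  have s1: "(\<Sum>xs\<in>bit_strings M. real (card (Y xs))) = real n * (2 ^ M / 2 ^ j)"
  proof -
    have "(\<Sum>xs\<in>bit_strings M. real (card (Y xs))) = (\<Sum>xs\<in>bit_strings M. real (card {u \<in> X. u \<in> Y xs}))"
      by (intro sum.cong refl) (auto simp: Y_def intro!: arg_cong[where f = card])
    also have "\<dots> = (\<Sum>u\<in>X. real (card {xs \<in> bit_strings M. u \<in> Y xs}))"
      by (rule sum_card_swap) (use X in auto)
    also have "\<dots> = real n * (2 ^ M / 2 ^ j)" by (simp add: c1 n_def)
    finally show ?thesis .
  qed
  have s2: "(\<Sum>xs\<in>bit_strings M. real (card (Y xs) * (card (Y xs) - 1))) = real (n * (n - 1)) * (2 ^ M / 4 ^ j)"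
  proof -
    have "(\<Sum>xs\<in>bit_strings M. real (card (Y xs) * (card (Y xs) - 1)))
        = (\<Sum>xs\<in>bit_strings M. real (card {p \<in> {p \<in> X \<times> X. fst p \<noteq> snd p}. fst p \<in> Y xs \<and> snd p \<in> Y xs}))"
      by (intro sum.cong refl, subst card_offdiag[symmetric])
        (auto simp: Y_def X intro!: arg_cong[where f = card])
    also have "\<dots> = (\<Sum>p\<in>{p \<in> X \<times> X. fst p \<noteq> snd p}. real (card {xs \<in> bit_strings M. fst p \<in> Y xs \<and> snd p \<in> Y xs}))"
      by (rule sum_card_swap) (use X in auto)
    also have "\<dots> = real (n * (n - 1)) * (2 ^ M / 4 ^ j)"
      by (simp only: sum.cong[OF refl c2] sum_constant card_offdiag[OF X(1)] n_def)
    finally show ?thesis .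
  qed
  have "real (card {xs \<in> bit_strings M. card (Y xs) = 1})
      = (\<Sum>xs\<in>bit_strings M. if card (Y xs) = 1 then 1 else 0)"
    by (simp add: sum.If_cases Int_def)
  moreover have "(\<Sum>xs\<in>bit_strings M. real (card (Y xs)) - real (card (Y xs) * (card (Y xs) - 1)))
      \<le> (\<Sum>xs\<in>bit_strings M. if card (Y xs) = 1 then 1 else 0)"
    by (intro sum_mono indicator_one_ge)
  moreover have "(\<Sum>xs\<in>bit_strings M. real (card (Y xs)) - real (card (Y xs) * (card (Y xs) - 1)))
     = real n * (2 ^ M / 2 ^ j) - real (n * (n - 1)) * (2 ^ M / 4 ^ j)"
    by (simp only: sum_subtractf s1 s2)
  moreover have "real (n * (n - 1)) * (2 ^ M / 4 ^ j) \<le> (real n)\<^sup>2 * (2 ^ M / 4 ^ j)"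
    by (intro mult_right_mono) (auto simp: power2_eq_square intro!: mult_left_mono)
  moreover have "real n * (2 ^ M / 2 ^ j) - (real n)\<^sup>2 * (2 ^ M / 4 ^ j) = 2 ^ M * (y - y * y)"
  proof -
    have "(4::real) ^ j = 2 ^ j * 2 ^ j" by (simp add: power_mult_distrib[symmetric])
    then show ?thesis by (simp add: y_def power2_eq_square algebra_simps)
  qed
  moreover have "2 ^ M * (3 / 16) \<le> 2 ^ M * (y - y * y)"
  proof -
    \<comment> \<open>The product equals \<open>16 * (y - y * y) - 3\<close>; the minimum of
      \<open>y - y * y\<close> on the interval is taken at \<open>y = 1/4\<close>.\<close>
    have "0 \<le> (4 * y - 1) * (3 - 4 * y)" using y by (intro mult_nonneg_nonneg) auto
    then have "3/16 \<le> y - y * y" by (simp add: algebra_simps)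
    then show ?thesis by (intro mult_left_mono) auto
  qed
  ultimately have good: "2 ^ M * (3 / 16) \<le> real (card {xs \<in> bit_strings M. card (Y xs) = 1})"
    by linarith
  have "{xs \<in> bit_strings M. card (Y xs) = 1} \<subseteq> {xs \<in> bit_strings M. isolates X (rows W W xs)}"
  proof safe
    fix xs assume "card (Y xs) = 1"
    then show "isolates X (rows W W xs)"
      using isolates_prefix[of j "rows W W xs" X] jpos jW by (simp add: take_rows Y_def)
  qed
  then have "card {xs \<in> bit_strings M. card (Y xs) = 1} \<le> card {xs \<in> bit_strings M. isolates X (rows W W xs)}"
    by (intro card_mono) auto
  then have "2 ^ M * (3 / 16) \<le> real (card {xs \<in> bit_strings M. isolates X (rows W W xs)})"
    using good by linarith
  then have "real (3 * 2 ^ M) \<le> real (16 * card {xs \<in> bit_strings M. isolates X (rows W W xs)})"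
    by simp
  then have "3 * 2 ^ M \<le> 16 * card {xs \<in> bit_strings M. isolates X (rows W W xs)}"
    by linarith
  then have "16 * card {xs \<in> bit_strings M. \<not> isolates X (rows W W xs)} \<le> 13 * 2 ^ M"
    using card_bit_strings_compl[of M "\<lambda>xs. isolates X (rows W W xs)"] by linarith
  then show ?thesis by (simp only: M_def W_def)
qed

section \<open>Elections: repeated trials over one block\<close>

text \<open>The leading bit of a flagged row tells the contenders that a new trial begins.\<close>

definition flag :: "bool list list \<Rightarrow> bool list list" where
  "flag rs = (case rs of [] \<Rightarrow> [] | r # rs' \<Rightarrow> (True # r) # map (Cons False) rs')"

primrec seed :: "nat \<Rightarrow> nat \<Rightarrow> bool list \<Rightarrow> bool list list" where
  "seed W 0 xs = []"
| "seed W (Suc t) xs = flag (rows W W (take (W * W) xs)) @ seed W t (drop (W * W) xs)"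

lemma length_flag [simp]: "length (flag rs) = length rs"
  by (cases rs) (auto simp: flag_def)

lemma length_seed [simp]: "length (seed W t xs) = t * W"
  by (induction t arbitrary: xs) auto

lemma seed_row_length:
  "length xs = t * (W * W) \<Longrightarrow> r \<in> set (seed W t xs) \<Longrightarrow> length r = Suc W"
proof (induction t arbitrary: xs)
  case (Suc t)
  have "length r' = W" if "r' \<in> set (rows W W (take (W * W) xs))" for r'
    using rows_length[OF _ that] Suc.prems by simp
  then have "r \<in> set (flag (rows W W (take (W * W) xs))) \<Longrightarrow> length r = Suc W"
    by (cases "rows W W (take (W * W) xs)") (auto simp: flag_def)
  then show ?case using Suc.IH[of "drop (W * W) xs"] Suc.prems by auto
qed simp

text \<open>A bound on the failure event of an election that mentions only the set \<open>X\<close>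
  and the bits, not reception; capture can only make an election succeed earlier.\<close>

primrec stuck :: "nat set \<Rightarrow> nat \<Rightarrow> nat \<Rightarrow> bool list \<Rightarrow> bool" where
  "stuck X W 0 xs \<longleftrightarrow> True"
| "stuck X W (Suc t) xs \<longleftrightarrow> \<not> isolates X (rows W W (take (W * W) xs)) \<and> stuck X W t (drop (W * W) xs)"

lemma card_stuck:
  "card {xs \<in> bit_strings (t * (W * W)). stuck X W t xs}
     = card {xs \<in> bit_strings (W * W). \<not> isolates X (rows W W xs)} ^ t"
proof (induction t)
  case (Suc t)
  show ?case
    using card_bit_strings_append[of "W * W" "t * (W * W)" "\<lambda>xs. \<not> isolates X (rows W W xs)" "stuck X W t"] Suc
    by simp
qed (simp add: bit_strings_def)

lemma card_stuck_le:
  assumes "finite X" "X \<subseteq> {..<2 ^ k}" "X \<noteq> {}"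
  shows "real (card {xs \<in> bit_strings (t * (Suc k * Suc k)). stuck X (Suc k) t xs})
    \<le> (13 / 16) ^ t * 2 ^ (t * (Suc k * Suc k))"
proof -
  let ?c = "card {xs \<in> bit_strings (Suc k * Suc k). \<not> isolates X (rows (Suc k) (Suc k) xs)}"
  have "real (16 * ?c) \<le> real (13 * 2 ^ (Suc k * Suc k))"
    using card_not_isolates_le[OF assms] by linarith
  then have "real ?c \<le> 13 / 16 * 2 ^ (Suc k * Suc k)" by simp
  then have "real ?c ^ t \<le> (13 / 16 * 2 ^ (Suc k * Suc k)) ^ t"
    by (intro power_mono) auto
  also have "\<dots> = (13 / 16) ^ t * 2 ^ (t * (Suc k * Suc k))"
    by (simp only: power_mult_distrib power_mult[symmetric] mult.commute)
  finally show ?thesis by (simp only: card_stuck of_nat_power)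
qed

text \<open>\<open>rc Y\<close> is the node that the token holder hears when the set \<open>Y\<close> transmits.\<close>

primrec elect :: "(nat set \<Rightarrow> nat option) \<Rightarrow> nat set \<Rightarrow> nat set \<Rightarrow> bool list list \<Rightarrow> nat option" where
  "elect rc X Y [] = None"
| "elect rc X Y (r # rs) =
     (let Y' = {u \<in> (if hd r then X else Y). survives (tl r) u}
      in case rc Y' of Some w \<Rightarrow> Some w | None \<Rightarrow> elect rc X Y' rs)"

lemma elect_in:
  assumes "\<And>Y w. Y \<subseteq> X \<Longrightarrow> rc Y = Some w \<Longrightarrow> w \<in> Y"
  shows "Y \<subseteq> X \<Longrightarrow> elect rc X Y rs = Some w \<Longrightarrow> w \<in> X"
proof (induction rs arbitrary: Y)
  case (Cons r rs)
  define Y' where "Y' = {u \<in> (if hd r then X else Y). survives (tl r) u}"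
  have Y': "Y' \<subseteq> X" using Cons.prems(1) by (auto simp: Y'_def)
  show ?case
  proof (cases "rc Y'")
    case None
    then show ?thesis using Cons.IH[OF Y'] Cons.prems(2) by (simp add: Y'_def[symmetric])
  next
    case (Some a)
    then show ?thesis using assms[OF Y' Some] Y' Cons.prems(2) by (auto simp: Y'_def[symmetric])
  qed
qed simp

text \<open>While the holder hears nothing, the transmitting sets are exactly those that
  \<open>isolates\<close> examines, and a singleton among them would have been heard. The rows
  \<open>ss\<close> then start from whatever set is left, hence the existential.\<close>

lemma elect_unflagged_None:
  assumes "\<And>u. u \<in> X \<Longrightarrow> rc {u} \<noteq> None"
  shows "Y \<subseteq> X \<Longrightarrow> elect rc X Y (map (Cons False) rs @ ss) = None
    \<Longrightarrow> \<not> isolates Y rs \<and> (\<exists>Y'\<subseteq>X. elect rc X Y' ss = None)"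
proof (induction rs arbitrary: Y)
  case (Cons r rs)
  define Y' where "Y' = {u \<in> Y. survives r u}"
  have Y': "Y' \<subseteq> X" using Cons.prems(1) by (auto simp: Y'_def)
  have n: "rc Y' = None" and e: "elect rc X Y' (map (Cons False) rs @ ss) = None"
    using Cons.prems(2) by (auto simp: Y'_def[symmetric] split: option.splits)
  have "card Y' \<noteq> 1"
    using n assms Y' by (metis card_1_singletonE insert_subset)
  then show ?case using Cons.IH[OF Y' e] by (simp add: Y'_def[symmetric])
qed auto

lemma elect_seed_None:
  assumes "\<And>u. u \<in> X \<Longrightarrow> rc {u} \<noteq> None" "W > 0"
  shows "Y \<subseteq> X \<Longrightarrow> elect rc X Y (seed W t xs) = None \<Longrightarrow> stuck X W t xs"
proof (induction t arbitrary: Y xs)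
  case (Suc t)
  obtain r rs where r: "rows W W (take (W * W) xs) = r # rs"
    using assms(2) by (cases W) auto
  let ?ss = "seed W t (drop (W * W) xs)"
  \<comment> \<open>A flagged row tests all of \<open>X\<close>, so it acts like an unflagged row
    with start set \<open>X\<close>, whatever \<open>Y\<close> was.\<close>
  have "elect rc X X ((False # r) # map (Cons False) rs @ ?ss) = None"
    using Suc.prems(2) r by (simp add: flag_def)
  then have "elect rc X X (map (Cons False) (r # rs) @ ?ss) = None" by simp
  then have "\<not> isolates X (r # rs) \<and> (\<exists>Y'\<subseteq>X. elect rc X Y' ?ss = None)"
    using elect_unflagged_None[of X rc X "r # rs" ?ss] assms(1) by blast
  then show ?case using Suc.IH r by auto
qed simp

section \<open>The depth-first tour as a function of the random blocks\<close>

text \<open>Visited nodes, stack with the token holder on top, and the helper of the holder. The helper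
  is the holder itself in its first election and later the child that returned the token. Block
  \<open>(u, True)\<close> is what \<open>u\<close> keeps for its own first election; block \<open>(u, False)\<close> is what it
  supplies to its parent.\<close>

type_synonym tour = "nat set \<times> nat list \<times> nat"

fun block_read :: "tour \<Rightarrow> (nat \<times> bool) option" where
  "block_read (Vis, [], hp) = None"
| "block_read (Vis, h # s, hp) = Some (hp, hp = h)"

text \<open>Covers all blocks that can still be read: an unvisited node has both, a node on the
  stack has not returned and still keeps its supply for the parent, and one block is about to be
  read.\<close>

definition fresh :: "tour \<Rightarrow> (nat \<times> bool) set" where
  "fresh st = {(u, c). u \<notin> fst st} \<union> {(u, c). u \<in> set (fst (snd st)) \<and> \<not> c}
     \<union> set_option (block_read st)"

locale traversal =
  fixes V :: "nat set" and src :: nat and nb :: "nat \<Rightarrow> nat set"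
    and winner :: "nat \<Rightarrow> nat set \<Rightarrow> bool list \<Rightarrow> nat option"
  assumes finV: "finite V" and srcV: "src \<in> V"
    and nbV: "nb u \<subseteq> V"
    and nb_sym: "v \<in> nb u \<Longrightarrow> u \<in> nb v"
    and nb_irrefl: "u \<notin> nb u"
    and winner_in: "X \<subseteq> nb h \<Longrightarrow> winner h X x = Some w \<Longrightarrow> w \<in> X"
    and conn: "src \<in> Z \<Longrightarrow> (\<And>u. u \<in> Z \<Longrightarrow> nb u \<subseteq> Z) \<Longrightarrow> V \<subseteq> Z"
begin

fun tstep :: "(nat \<times> bool \<Rightarrow> bool list) \<Rightarrow> tour \<Rightarrow> tour" where
  "tstep g (Vis, [], hp) = (Vis, [], hp)"
| "tstep g (Vis, h # s, hp) = (case winner h (nb h - Vis) (g (hp, hp = h)) of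
      Some w \<Rightarrow> (insert w Vis, w # h # s, w)
    | None \<Rightarrow> (Vis, s, h))"

primrec tour :: "(nat \<times> bool \<Rightarrow> bool list) \<Rightarrow> nat \<Rightarrow> tour" where
  "tour g 0 = ({src}, [src], src)"
| "tour g (Suc k) = tstep g (tour g k)"

fun chain :: "nat list \<Rightarrow> bool" where
  "chain [] \<longleftrightarrow> True"
| "chain [x] \<longleftrightarrow> x = src"
| "chain (x # y # s) \<longleftrightarrow> y \<in> nb x \<and> chain (y # s)"

text \<open>The last clause keeps the helper in range of the holder;
  \<open>hp \<notin> set s\<close> ensures that a supply block, once read, is not counted again as
  lying on the stack.\<close>

fun tour_inv :: "tour \<Rightarrow> bool" where
  "tour_inv (Vis, s, hp) \<longleftrightarrow> distinct s \<and> set s \<subseteq> Vis \<and> Vis \<subseteq> V \<and> src \<in> Vis \<and> hp \<in> Vis \<and> chain s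
     \<and> (s \<noteq> [] \<longrightarrow> hp = hd s \<or> (hp \<notin> set s \<and> hp \<in> nb (hd s)))"

lemma tour_inv_tstep: "tour_inv st \<Longrightarrow> tour_inv (tstep g st)"
proof (induction g st rule: tstep.induct)
  case (2 g Vis h s hp)
  show ?case
  proof (cases "winner h (nb h - Vis) (g (hp, hp = h))")
    case None
    then show ?thesis
      using 2 by (cases s) (auto intro: nb_sym)
  next
    case (Some w)
    then have "w \<in> nb h - Vis" using winner_in[OF Diff_subset] by blast
    then show ?thesis using 2 Some nbV by (auto intro: nb_sym)
  qed
qed auto

lemma tour_inv_tour: "tour_inv (tour g k)"
  by (induction k) (auto simp: srcV tour_inv_tstep simp del: tour_inv.simps, auto simp: srcV)

text \<open>A push makes the new node's own block the pending one, a pop the popped node's supply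
  block. Both were fresh before and differ from the block just read.\<close>

lemma fresh_tstep:
  assumes "tour_inv st"
  shows "fresh (tstep g st) \<subseteq> fresh st - set_option (block_read st) \<or> block_read st = None"
  using assms
proof (induction g st rule: tstep.induct)
  case (2 g Vis h s hp)
  show ?case
  proof (cases "winner h (nb h - Vis) (g (hp, hp = h))")
    case None
    then show ?thesis
      using 2 by (cases s) (auto simp: fresh_def)
  next
    case (Some w)
    then have "w \<in> nb h - Vis" using winner_in[OF Diff_subset] by blast
    then show ?thesis using 2 Some nbV by (auto simp: fresh_def)
  qed
qed auto

lemma block_read_None_tstep: "block_read st = None \<Longrightarrow> tstep g st = st"
  by (induction g st rule: tstep.induct) auto

lemma fresh_antimono: "j \<le> k \<Longrightarrow> fresh (tour g k) \<subseteq> fresh (tour g j)"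
proof (induction k)
  case (Suc k)
  have "fresh (tour g (Suc k)) \<subseteq> fresh (tour g k)"
    using fresh_tstep[OF tour_inv_tour[of g k], of g] block_read_None_tstep[of "tour g k" g] by auto
  then show ?case using Suc by (cases "j = Suc k") auto
qed simp

lemma block_read_once:
  assumes "block_read (tour g j) = Some b" "block_read (tour g k) = Some b"
  shows "j = k"
proof -
  have *: False if "j < k" "block_read (tour g j) = Some b" "block_read (tour g k) = Some b" for j k
  proof -
    have "b \<in> fresh (tour g k)" using that by (simp add: fresh_def)
    then have "b \<in> fresh (tour g (Suc j))" using fresh_antimono[of "Suc j" k g] that by auto
    then show False using fresh_tstep[OF tour_inv_tour[of g j], of g] that by auto
  qed
  show ?thesis using *[of j k] *[of k j] assms by (metis linorder_neqE_nat)
qed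

text \<open>Since a block is read at most once, the tour up to that moment, and hence the set of
  contenders, does not depend on the contents of the block.\<close>

lemma tstep_upd: "block_read st \<noteq> Some b \<Longrightarrow> tstep (g(b := x)) st = tstep g st"
  by (induction g st rule: tstep.induct) auto

lemma tour_upd:
  "(\<And>j. j < k \<Longrightarrow> block_read (tour g j) \<noteq> Some b) \<Longrightarrow> tour (g(b := x)) k = tour g k"
  by (induction k) (auto simp: tstep_upd)

fun fails :: "(nat \<times> bool \<Rightarrow> bool list) \<Rightarrow> tour \<Rightarrow> bool" where
  "fails g (Vis, [], hp) \<longleftrightarrow> False"
| "fails g (Vis, h # s, hp) \<longleftrightarrow> nb h - Vis \<noteq> {} \<and> winner h (nb h - Vis) (g (hp, hp = h)) = None"

lemma fails_upd_eq:
  assumes "fails (g(b := x)) st" "block_read st = Some b"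
  shows "\<exists>h s hp Vis. st = (Vis, h # s, hp) \<and> nb h - Vis \<noteq> {} \<and> winner h (nb h - Vis) x = None"
  using assms by (cases st rule: block_read.cases) auto

lemma card_fails_block:
  assumes winner: "\<And>h X. X \<subseteq> nb h \<Longrightarrow> X \<noteq> {} \<Longrightarrow> real (card {x \<in> bit_strings M. winner h X x = None}) \<le> c"
    and c: "0 \<le> c"
  shows "real (card {x \<in> bit_strings M. \<exists>k. fails (g(b := x)) (tour (g(b := x)) k)
    \<and> block_read (tour (g(b := x)) k) = Some b}) \<le> c"
proof (cases "\<exists>k. block_read (tour g k) = Some b")
  case False
  then have "tour (g(b := x)) k = tour g k" for x k
    by (intro tour_upd) auto
  then show ?thesis using False c by simp
next
  case True
  define k where "k = (LEAST k. block_read (tour g k) = Some b)"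
  have k: "block_read (tour g k) = Some b" unfolding k_def by (rule LeastI_ex[OF True])
  have less: "block_read (tour g j) \<noteq> Some b" if "j < k" for j
    using not_less_Least that unfolding k_def by blast
  have eq: "tour (g(b := x)) k = tour g k" for x
    by (rule tour_upd) (rule less)
  obtain Vis h s hp where st: "tour g k = (Vis, h # s, hp)"
    using k by (cases "tour g k" rule: block_read.cases) auto
  have sub: "{x \<in> bit_strings M. \<exists>k. fails (g(b := x)) (tour (g(b := x)) k)
      \<and> block_read (tour (g(b := x)) k) = Some b}
    \<subseteq> {x \<in> bit_strings M. nb h - Vis \<noteq> {} \<and> winner h (nb h - Vis) x = None}"
  proof (intro subsetI CollectI conjI)
    fix x
    assume "x \<in> {x \<in> bit_strings M. \<exists>k. fails (g(b := x)) (tour (g(b := x)) k)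
      \<and> block_read (tour (g(b := x)) k) = Some b}"
    then obtain i where i: "x \<in> bit_strings M" "fails (g(b := x)) (tour (g(b := x)) i)"
        "block_read (tour (g(b := x)) i) = Some b"
      by blast
    \<comment> \<open>By \<open>eq\<close>, step \<open>k\<close> reads \<open>b\<close> for every
      \<open>x\<close>; since there is only one such step, the failing step is this one, with the
      fixed contender set \<open>nb h - Vis\<close>.\<close>
    have "i = k" using block_read_once[of "g(b := x)" i b k] i eq k by simp
    then have f: "fails (g(b := x)) (tour g k)" using i eq by simp
    show "x \<in> bit_strings M" by fact
    show "nb h - Vis \<noteq> {}" "winner h (nb h - Vis) x = None"
      using fails_upd_eq[OF f k] st by auto
  qed
  show ?thesis
  proof (cases "nb h - Vis = {}")
    case True
    then have "{x \<in> bit_strings M. nb h - Vis \<noteq> {} \<and> winner h (nb h - Vis) x = None} = {}" by simp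
    then show ?thesis using sub c by (simp only: subset_empty card.empty)
  next
    case False
    have "card {x \<in> bit_strings M. \<exists>k. fails (g(b := x)) (tour (g(b := x)) k)
        \<and> block_read (tour (g(b := x)) k) = Some b}
      \<le> card {x \<in> bit_strings M. winner h (nb h - Vis) x = None}"
      by (rule card_mono) (use sub in auto)
    then show ?thesis using winner[of "nb h - Vis" h] False by (meson Diff_subset of_nat_mono order_trans)
  qed
qed

section \<open>Termination and completeness of the tour\<close>

fun explored :: "tour \<Rightarrow> bool" where
  "explored (Vis, s, hp) \<longleftrightarrow> (\<forall>u \<in> Vis - set s. nb u \<subseteq> Vis)"

lemma explored_tstep:
  "tour_inv st \<Longrightarrow> explored st \<Longrightarrow> \<not> fails g st \<Longrightarrow> explored (tstep g st)"
  by (induction g st rule: tstep.induct) (auto split: option.splits)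

text \<open>Potential function: an unvisited node still owes a push and a pop, a node on the stack a
  pop. Its initial value \<open>2 * card V - 1\<close> bounds the number of elections.\<close>

fun todo :: "tour \<Rightarrow> nat" where
  "todo (Vis, s, hp) = 2 * card (V - Vis) + length s"

lemma todo_tstep:
  "tour_inv st \<Longrightarrow> fst (snd st) \<noteq> [] \<Longrightarrow> Suc (todo (tstep g st)) \<le> todo st"
proof (induction g st rule: tstep.induct)
  case (2 g Vis h s hp)
  show ?case
  proof (cases "winner h (nb h - Vis) (g (hp, hp = h))")
    case (Some w)
    then have "w \<in> nb h - Vis" using winner_in[OF Diff_subset] by blast
    then have w: "w \<in> V - Vis" using nbV by blast
    have "card (V - insert w Vis) = card (V - Vis) - 1"
      using w finV by (metis Diff_insert card_Diff_singleton)
    moreover have "card (V - Vis) > 0" using w finV by (auto simp: card_gt_0_iff)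
    ultimately show ?thesis using Some by simp
  qed simp
qed auto

text \<open>Once the stack is empty, \<open>explored\<close> makes the visited set closed under
  neighbours, and it contains the source; connectivity does the rest.\<close>

lemma tour_complete:
  assumes ok: "\<And>k. \<not> fails g (tour g k)"
  shows "\<exists>hp. tour g (2 * card V - 1) = (V, [], hp)"
proof -
  have ex: "explored (tour g k)" for k
    by (induction k) (auto simp: explored_tstep tour_inv_tour ok simp del: explored.simps, simp)
  have "fst (snd (tour g k)) = [] \<or> todo (tour g k) + k \<le> 2 * card V - 1" for k
  proof (induction k)
    case 0
    have "card (V - {src}) = card V - 1" using srcV finV by simp
    moreover have "card V > 0" using srcV finV by (auto simp: card_gt_0_iff)
    ultimately show ?case by simp
  next
    case (Suc k)
    show ?case
    proof (cases "fst (snd (tour g k)) = []")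
      case True
      then show ?thesis by (cases "tour g k") auto
    next
      case False
      then show ?thesis using Suc todo_tstep[OF tour_inv_tour[of g k] False, of g] by auto
    qed
  qed
  from this[of "2 * card V - 1"] have e: "fst (snd (tour g (2 * card V - 1))) = []"
    by (cases "tour g (2 * card V - 1)") auto
  obtain Vis hp where t: "tour g (2 * card V - 1) = (Vis, [], hp)"
    using e by (cases "tour g (2 * card V - 1)") auto
  have "V \<subseteq> Vis"
    using ex[of "2 * card V - 1"] tour_inv_tour[of g "2 * card V - 1"] t by (intro conn) auto
  then have "Vis = V" using tour_inv_tour[of g "2 * card V - 1"] t by auto
  then show ?thesis using t by auto
qed

end

section \<open>Resampling a single block of the uniform bit space\<close>

definition block :: "nat \<Rightarrow> (nat \<Rightarrow> bool list) \<Rightarrow> nat \<times> bool \<Rightarrow> bool list" where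
  "block M bits b = (if snd b then take M (bits (fst b)) else drop M (bits (fst b)))"

definition resample :: "nat \<Rightarrow> nat \<times> bool \<Rightarrow> (nat \<Rightarrow> bool list) \<Rightarrow> bool list \<Rightarrow> (nat \<Rightarrow> bool list)" where
  "resample M b bits x = bits(fst b :=
     (if snd b then x @ drop M (bits (fst b)) else take M (bits (fst b)) @ x))"

definition bit_space :: "nat \<Rightarrow> nat set \<Rightarrow> (nat \<Rightarrow> bool list) set" where
  "bit_space M V = PiE_dflt V [] (\<lambda>_. bit_strings (2 * M))"

lemma finite_bit_space: "finite V \<Longrightarrow> finite (bit_space M V)"
  by (auto simp: bit_space_def intro: finite_PiE_dflt)

lemma bit_space_length: "bits \<in> bit_space M V \<Longrightarrow> u \<in> V \<Longrightarrow> length (bits u) = 2 * M"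
  by (auto simp: bit_space_def PiE_dflt_def bit_strings_def)

lemma bit_space_resample:
  "bits \<in> bit_space M V \<Longrightarrow> fst b \<in> V \<Longrightarrow> x \<in> bit_strings M \<Longrightarrow> resample M b bits x \<in> bit_space M V"
  by (auto simp: bit_space_def PiE_dflt_def bit_strings_def resample_def)

lemma block_resample:
  assumes "bits \<in> bit_space M V" "fst b \<in> V" "x \<in> bit_strings M"
  shows "block M (resample M b bits x) = (block M bits)(b := x)"
  using assms bit_space_length[OF assms(1,2)]
  by (intro ext) (auto simp: block_def resample_def bit_strings_def prod_eq_iff)

lemma block_strs: "bits \<in> bit_space M V \<Longrightarrow> fst b \<in> V \<Longrightarrow> block M bits b \<in> bit_strings M"
  using bit_space_length by (auto simp: block_def bit_strings_def)

lemma resample_resample: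
  assumes "bits \<in> bit_space M V" "fst b \<in> V" "x \<in> bit_strings M"
  shows "resample M b (resample M b bits x) (block M bits b) = bits"
  using assms bit_space_length[OF assms(1,2)]
  by (intro ext) (auto simp: block_def resample_def bit_strings_def)

text \<open>Exchanging block \<open>b\<close> with a fresh string \<open>x\<close> is an involution
  on pairs. Resampling therefore preserves the uniform distribution, and a bound valid with all
  other bits fixed holds overall.\<close>

lemma card_resample_le:
  assumes V: "finite V" and b: "fst b \<in> V"
    and le: "\<And>bits. bits \<in> bit_space M V
      \<Longrightarrow> real (card {x \<in> bit_strings M. resample M b bits x \<in> E}) \<le> p * 2 ^ M"
  shows "real (card (bit_space M V \<inter> E)) \<le> p * real (card (bit_space M V))"
proof -
  let ?O = "bit_space M V"
  let ?f = "\<lambda>(bits, x). (resample M b bits x, block M bits b)"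
  have "bij_betw ?f (SIGMA bits:?O. {x \<in> bit_strings M. resample M b bits x \<in> E}) ((?O \<inter> E) \<times> bit_strings M)"
    by (rule bij_betw_byWitness[where f' = ?f])
      (use b in \<open>auto simp: resample_resample bit_space_resample block_strs block_resample\<close>)
  from bij_betw_same_card[OF this]
  have "(\<Sum>bits\<in>?O. card {x \<in> bit_strings M. resample M b bits x \<in> E}) = card (?O \<inter> E) * 2 ^ M"
    using finite_bit_space[OF V] by (simp add: card_SigmaI card_cartesian_product)
  from arg_cong[OF this, of real]
  have "real (card (?O \<inter> E)) * 2 ^ M
      = (\<Sum>bits\<in>?O. real (card {x \<in> bit_strings M. resample M b bits x \<in> E}))"
    by simp
  also have "\<dots> \<le> (\<Sum>bits\<in>?O. p * 2 ^ M)" by (intro sum_mono le)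
  finally show ?thesis by (simp add: mult.commute)
qed

context traversal
begin

text \<open>The union runs over blocks, not over steps: a block is a fixed coordinate of the sample
  space, while the block read at a given step is itself random.\<close>

lemma card_fails_le:
  assumes winner: "\<And>h X. X \<subseteq> nb h \<Longrightarrow> X \<noteq> {} \<Longrightarrow> real (card {x \<in> bit_strings M. winner h X x = None}) \<le> p * 2 ^ M"
    and p: "0 \<le> p"
  shows "real (card (bit_space M V \<inter> {bits. \<exists>k. fails (block M bits) (tour (block M bits) k)}))
    \<le> 2 * real (card V) * p * real (card (bit_space M V))"
proof -
  let ?E = "\<lambda>b. {bits. \<exists>k. fails (block M bits) (tour (block M bits) k)
    \<and> block_read (tour (block M bits) k) = Some b}"
  let ?B = "V \<times> (UNIV :: bool set)"
  have sub: "bit_space M V \<inter> {bits. \<exists>k. fails (block M bits) (tour (block M bits) k)}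
      \<subseteq> (\<Union>b\<in>?B. bit_space M V \<inter> ?E b)"
  proof safe
    fix bits k
    assume f: "fails (block M bits) (tour (block M bits) k)" and bits: "bits \<in> bit_space M V"
    obtain Vis h s hp where st: "tour (block M bits) k = (Vis, h # s, hp)"
      using f by (cases "tour (block M bits) k" rule: block_read.cases) auto
    then have "hp \<in> V" using tour_inv_tour[of "block M bits" k] by auto
    then show "bits \<in> (\<Union>b\<in>?B. bit_space M V \<inter> ?E b)"
      using f bits st by (intro UN_I[of "(hp, hp = h)"]) (auto simp del: fails.simps intro!: exI[of _ k])
  qed
  have one: "real (card (bit_space M V \<inter> ?E b)) \<le> p * real (card (bit_space M V))" if "b \<in> ?B" for b
  proof (rule card_resample_le[OF finV])
    show bV: "fst b \<in> V" using that by auto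
    fix bits assume bits: "bits \<in> bit_space M V"
    have "{x \<in> bit_strings M. resample M b bits x \<in> ?E b}
      = {x \<in> bit_strings M. \<exists>k. fails ((block M bits)(b := x)) (tour ((block M bits)(b := x)) k)
          \<and> block_read (tour ((block M bits)(b := x)) k) = Some b}"
      using block_resample[OF bits bV] by auto
    then show "real (card {x \<in> bit_strings M. resample M b bits x \<in> ?E b}) \<le> p * 2 ^ M"
      using card_fails_block[of M "p * 2 ^ M", OF winner] p by simp
  qed
  have "card (bit_space M V \<inter> {bits. \<exists>k. fails (block M bits) (tour (block M bits) k)})
      \<le> card (\<Union>b\<in>?B. bit_space M V \<inter> ?E b)"
    by (rule card_mono[OF _ sub]) (use finV finite_bit_space in auto)
  also have "\<dots> \<le> (\<Sum>b\<in>?B. card (bit_space M V \<inter> ?E b))"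
    by (rule card_UN_le) (use finV in auto)
  finally have "real (card (bit_space M V \<inter> {bits. \<exists>k. fails (block M bits) (tour (block M bits) k)}))
      \<le> (\<Sum>b\<in>?B. real (card (bit_space M V \<inter> ?E b)))"
    by (simp only: of_nat_sum[symmetric] of_nat_le_iff)
  also have "\<dots> \<le> (\<Sum>b\<in>?B. p * real (card (bit_space M V)))" by (intro sum_mono one)
  also have "\<dots> = 2 * real (card V) * p * real (card (bit_space M V))"
    by (simp add: card_cartesian_product)
  finally show ?thesis .
qed

end

section \<open>The protocol\<close>

primrec bin :: "nat \<Rightarrow> nat \<Rightarrow> bool list" where
  "bin 0 n = []"
| "bin (Suc k) n = odd n # bin k (n div 2)"

primrec unbin :: "bool list \<Rightarrow> nat" where
  "unbin [] = 0"
| "unbin (x # xs) = of_bool x + 2 * unbin xs"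

lemma length_bin [simp]: "length (bin k n) = k"
  by (induction k arbitrary: n) auto

lemma unbin_bin: "n < 2 ^ k \<Longrightarrow> unbin (bin k n) = n"
  by (induction k arbitrary: n) auto

datatype pmsg = Request nat | Word "bool list" | Query "bool list" | Contend nat | Token nat nat | Return nat nat

text \<open>A slot of an election takes four rounds: the holder asks its helper \<open>hp\<close> for a row
  (\<open>Ask hp\<close>), waits for it (\<open>Await hp\<close>), broadcasts it to the contenders (\<open>Pose hp r\<close>) and
  waits for a contender (\<open>Listen hp\<close>). All other nodes only react to what they heard in the
  preceding round.\<close>

datatype mode = Idle | Out pmsg | Ask nat | Await nat | Pose nat "bool list" | Listen nat

datatype node = Node (width: nat) (name: nat) (parent: nat) (visited: bool) (alive: bool)
  (own: "bool list list") (aux: "bool list list") (mode: mode)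

instance pmsg :: countable by countable_datatype
instance mode :: countable by countable_datatype
instance node :: countable by countable_datatype

text \<open>\<open>take (K + 2)\<close> leaves rows of the protocol's length alone and makes the
  length bound hold for every state, without an invariant on stored rows.\<close>

fun enc :: "nat \<Rightarrow> pmsg \<Rightarrow> bool list" where
  "enc K (Request a) = [False, False, False] @ bin K a"
| "enc K (Word r) = [False, False, True] @ take (K + 2) r"
| "enc K (Query r) = [False, True, False] @ take (K + 2) r"
| "enc K (Contend a) = [False, True, True] @ bin K a"
| "enc K (Token a b) = [True, False, False] @ bin K a @ bin K b"
| "enc K (Return a b) = [True, False, True] @ bin K a @ bin K b"

fun dec :: "nat \<Rightarrow> bool list \<Rightarrow> pmsg" where
  "dec K (False # False # False # l) = Request (unbin l)"
| "dec K (False # False # True # l) = Word l"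
| "dec K (False # True # False # l) = Query l"
| "dec K (False # True # True # l) = Contend (unbin l)"
| "dec K (True # False # False # l) = Token (unbin (take K l)) (unbin (drop K l))"
| "dec K (True # False # True # l) = Return (unbin (take K l)) (unbin (drop K l))"
| "dec K _ = Word []"

fun fits :: "nat \<Rightarrow> pmsg \<Rightarrow> bool" where
  "fits K (Request a) \<longleftrightarrow> a < 2 ^ K"
| "fits K (Word r) \<longleftrightarrow> length r = K + 2"
| "fits K (Query r) \<longleftrightarrow> length r = K + 2"
| "fits K (Contend a) \<longleftrightarrow> a < 2 ^ K"
| "fits K (Token a b) \<longleftrightarrow> a < 2 ^ K \<and> b < 2 ^ K"
| "fits K (Return a b) \<longleftrightarrow> a < 2 ^ K \<and> b < 2 ^ K"

lemma dec_enc: "fits K m \<Longrightarrow> dec K (enc K m) = m"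
  by (cases m) (auto simp: unbin_bin)

lemma length_enc: "length (enc K m) \<le> 2 * K + 5"
  by (cases m) auto

fun sends :: "node \<Rightarrow> pmsg option" where
  "sends (Node K v p vs al a b (Out m)) = Some m"
| "sends (Node K v p vs al a b (Ask hp)) = Some (Request hp)"
| "sends (Node K v p vs al a b (Pose hp r)) = Some (Query r)"
| "sends _ = None"

text \<open>A helper whose supply is exhausted stays silent, and this silence tells the holder that
  the election is over. \<open>Word\<close> and \<open>Contend\<close> mean nothing to
  bystanders.\<close>

fun hear :: "node \<Rightarrow> pmsg \<Rightarrow> node" where
  "hear (Node K v p vs al a b m) (Request x) = (case b of
      [] \<Rightarrow> Node K v p vs al a b m
    | r # rs \<Rightarrow> if x = v then Node K v p vs al a rs (Out (Word r)) else Node K v p vs al a b m)"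
| "hear (Node K v p vs al a b m) (Query r) = (if vs then Node K v p vs al a b m
    else if (hd r \<or> al) \<and> survives (tl r) v then Node K v p vs True a b (Out (Contend v))
    else Node K v p vs False a b m)"
| "hear (Node K v p vs al a b m) (Token x y) =
    (if x = v then Node K v y True al a b (Ask v) else Node K v p vs al a b m)"
| "hear (Node K v p vs al a b m) (Return x y) =
    (if x = v then Node K v p vs al a b (Ask y) else Node K v p vs al a b m)"
| "hear c _ = c"

fun upd :: "node \<Rightarrow> pmsg option \<Rightarrow> node" where
  "upd (Node K v p vs al a b (Out m)) h = Node K v p vs al a b Idle"
| "upd (Node K v p vs al a b (Ask hp)) h = Node K v p vs al a b (Await hp)"
| "upd (Node K v p vs al a b (Await hp)) h =
    (if hp = v then (case a of
        [] \<Rightarrow> Node K v p vs al a b (Out (Return p v))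
      | r # rs \<Rightarrow> Node K v p vs al rs b (Pose hp r))
     else (case h of Some (Word r) \<Rightarrow> Node K v p vs al a b (Pose hp r)
      | _ \<Rightarrow> Node K v p vs al a b (Out (Return p v))))"
| "upd (Node K v p vs al a b (Pose hp r)) h = Node K v p vs al a b (Listen hp)"
| "upd (Node K v p vs al a b (Listen hp)) h = (case h of
      Some (Contend w) \<Rightarrow> Node K v p vs al a b (Out (Token w v))
    | _ \<Rightarrow> Node K v p vs al a b (Ask hp))"
| "upd (Node K v p vs al a b Idle) h = (case h of
      None \<Rightarrow> Node K v p vs al a b Idle
    | Some m \<Rightarrow> hear (Node K v p vs al a b Idle) m)"

lemma width_hear [simp]: "width (hear c m) = width c"
  by (induction c m rule: hear.induct) (auto split: list.splits)

lemma width_upd [simp]: "width (upd c h) = width c"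
  by (induction c h rule: upd.induct) (auto split: list.splits option.splits pmsg.splits)

definition init :: "nat \<Rightarrow> nat \<Rightarrow> nat \<Rightarrow> bool \<Rightarrow> bool list \<Rightarrow> node" where
  "init K t v s bits = (let M = t * (Suc K * Suc K) in
     Node K v 0 s False (seed (Suc K) t (take M bits)) (seed (Suc K) t (drop M bits))
       (if s then Ask v else Idle))"

section \<open>Reception and the single rounds of the protocol\<close>

definition reception :: "sinr \<Rightarrow> (nat \<Rightarrow> position) \<Rightarrow> nat set \<Rightarrow> nat \<Rightarrow> nat option" where
  "reception S pos T u = (if \<exists>x. sinr_receives S pos T x u
     then Some (SOME x. sinr_receives S pos T x u) else None)"

locale network =
  fixes S :: sinr and N :: nat and V :: "nat set" and pos :: "nat \<Rightarrow> position" and src K t :: nat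
  assumes ok: "sinr_ok S" and valid: "valid_network S N V pos src" and K: "N < 2 ^ K"
begin

definition nb :: "nat \<Rightarrow> nat set" where
  "nb u = {v. comm_adj S V pos u v}"

abbreviation rc :: "nat set \<Rightarrow> nat \<Rightarrow> nat option" where
  "rc \<equiv> reception S pos"

lemma V_N: "V \<subseteq> {1..N}" and srcV: "src \<in> V" and inj: "inj_on pos V"
  and conn: "comm_connected S V pos"
  using valid by (auto simp: valid_network_def)

lemma finV: "finite V"
  using V_N finite_subset by blast

lemma V_less: "u \<in> V \<Longrightarrow> u < 2 ^ K"
  using V_N K by fastforce

lemma nbV: "nb u \<subseteq> V"
  by (auto simp: nb_def comm_adj_def)

lemma nb_sym: "v \<in> nb u \<Longrightarrow> u \<in> nb v"
  by (auto simp: nb_def comm_adj_def dist_commute)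

lemma nb_irrefl [simp]: "u \<notin> nb u"
  by (auto simp: nb_def comm_adj_def)

lemma receives_nb:
  assumes "sinr_receives S pos T x u" "T \<subseteq> V" "u \<in> V"
  shows "x \<in> T" "u \<notin> T" "u \<in> nb x"
  using assms by (auto simp: sinr_receives_def nb_def comm_adj_def)

text \<open>A node transmitting alone meets no interference, and the weak-sensitivity radius lies
  within the radius at which the signal beats the noise.\<close>

lemma receives_single:
  assumes "u \<in> nb v"
  shows "sinr_receives S pos {v} v u"
proof -
  let ?d = "dist (pos v) (pos u)" and ?q = "s_P S / (s_noise S * s_beta S)"
  have uv: "u \<in> V" "v \<in> V" "u \<noteq> v" and le: "?d \<le> (1 - s_eps S) * sinr_range S"
    using assms by (auto simp: nb_def comm_adj_def)
  have P: "s_P S > 0" and a: "s_alpha S > 2" and no: "s_noise S > 0" and be: "s_beta S \<ge> 1"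
    and e: "0 < s_eps S" "s_eps S < 1"
    using ok by (auto simp: sinr_ok_def)
  have "pos v \<noteq> pos u" using uv inj by (metis inj_onD)
  then have d: "?d > 0" by simp
  have q: "?q > 0" using P no be by simp
  have "(1 - s_eps S) * sinr_range S \<le> 1 * sinr_range S"
    using e by (intro mult_right_mono) (auto simp: sinr_range_def)
  then have "?d \<le> ?q powr (1 / s_alpha S)" using le by (simp add: sinr_range_def)
  then have "?d powr s_alpha S \<le> (?q powr (1 / s_alpha S)) powr s_alpha S"
    using d a by (intro powr_mono2) auto
  also have "\<dots> = ?q" using a q P no be by (simp add: powr_powr)
  finally have "?d powr s_alpha S * (s_noise S * s_beta S) \<le> s_P S"
    using no be by (simp add: pos_le_divide_eq)
  then have "s_beta S \<le> s_P S / ?d powr s_alpha S / s_noise S"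
    using d no by (simp add: pos_le_divide_eq mult_ac)
  then have "s_beta S \<le> s_P S * ?d powr (- s_alpha S) / s_noise S"
    by (simp add: powr_minus divide_inverse)
  then show ?thesis using uv le by (simp add: sinr_receives_def)
qed

lemma rc_Some:
  assumes "rc T u = Some x" "T \<subseteq> V" "u \<in> V"
  shows "x \<in> T" "u \<notin> T" "u \<in> nb x"
proof -
  have "sinr_receives S pos T x u"
    using assms(1) unfolding reception_def by (metis option.distinct(1) option.inject someI_ex)
  then show "x \<in> T" "u \<notin> T" "u \<in> nb x" using receives_nb assms by blast+
qed

lemma rc_single:
  assumes "v \<in> V" "u \<in> V"
  shows "rc {v} u = (if u \<in> nb v then Some v else None)"
proof (cases "u \<in> nb v")
  case True
  then have "rc {v} u \<noteq> None" using receives_single by (auto simp: reception_def)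
  then show ?thesis using rc_Some[of "{v}" u] assms True by fastforce
next
  case False
  have "rc {v} u = None"
  proof (rule ccontr)
    assume "rc {v} u \<noteq> None"
    then obtain x where "rc {v} u = Some x" by blast
    then show False using rc_Some[of "{v}" u x] assms False by auto
  qed
  then show ?thesis using False by simp
qed

lemma rc_empty [simp]: "rc {} u = None"
  by (auto simp: reception_def sinr_receives_def)

lemma closed_all:
  assumes "src \<in> Z" "\<And>u. u \<in> Z \<Longrightarrow> nb u \<subseteq> Z"
  shows "V \<subseteq> Z"
proof
  fix v assume "v \<in> V"
  then have "(src, v) \<in> {(x, y). comm_adj S V pos x y}\<^sup>*"
    using conn srcV by (auto simp: comm_connected_def)
  then show "v \<in> Z"
    by (induction rule: rtrancl_induct) (use assms in \<open>auto simp: nb_def\<close>)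
qed

definition winner :: "nat \<Rightarrow> nat set \<Rightarrow> bool list \<Rightarrow> nat option" where
  "winner h X x = (if h \<in> V then elect (\<lambda>Y. rc Y h) X {} (seed (Suc K) t x) else None)"

sublocale traversal V src nb winner
proof
  show "finite V" "src \<in> V" "\<And>u. nb u \<subseteq> V" "\<And>u. u \<notin> nb u" by (simp_all add: finV srcV nbV)
  show "\<And>u v. v \<in> nb u \<Longrightarrow> u \<in> nb v" by (rule nb_sym)
  show "\<And>Z. src \<in> Z \<Longrightarrow> (\<And>u. u \<in> Z \<Longrightarrow> nb u \<subseteq> Z) \<Longrightarrow> V \<subseteq> Z" by (rule closed_all)
  fix X h x w
  assume X: "X \<subseteq> nb h" and e: "winner h X x = Some w"
  then have h: "h \<in> V" by (auto simp: winner_def split: if_splits)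
  have "elect (\<lambda>Y. rc Y h) X {} (seed (Suc K) t x) = Some w" using e h by (simp add: winner_def)
  then show "w \<in> X"
    by (rule elect_in[rotated 2]) (use X nbV rc_Some(1) h in \<open>blast+\<close>)
qed

definition transmit :: "(nat \<Rightarrow> node) \<Rightarrow> nat set" where
  "transmit L = {v \<in> V. sends (L v) \<noteq> None}"

definition heard :: "(nat \<Rightarrow> node) \<Rightarrow> nat \<Rightarrow> pmsg option" where
  "heard L u = map_option (\<lambda>x. dec (width (L u)) (enc (width (L x)) (the (sends (L x)))))
     (rc (transmit L) u)"

definition nstep :: "(nat \<Rightarrow> node) \<Rightarrow> (nat \<Rightarrow> node)" where
  "nstep L = (\<lambda>u. if u \<in> V then upd (L u) (heard L u) else L u)"

definition config :: "(nat \<Rightarrow> nat) \<Rightarrow> nat set \<Rightarrow> (nat \<Rightarrow> bool) \<Rightarrow> (nat \<Rightarrow> bool list list)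
    \<Rightarrow> (nat \<Rightarrow> bool list list) \<Rightarrow> (nat \<Rightarrow> mode) \<Rightarrow> (nat \<Rightarrow> node)" where
  "config pr Vis al a b md = (\<lambda>u. Node K u (pr u) (u \<in> Vis) (al u) (a u) (b u) (md u))"

definition only :: "nat \<Rightarrow> mode \<Rightarrow> (nat \<Rightarrow> mode)" where
  "only h m = (\<lambda>_. Idle)(h := m)"

text \<open>Every round except the answer of the contenders has at most one transmitter, whose
  neighbours, and only they, hear it.\<close>

lemma nstep_single:
  assumes "v \<in> V" "sends (config pr Vis al a b md v) = Some m" "fits K m"
    and "\<And>u. u \<in> V \<Longrightarrow> u \<noteq> v \<Longrightarrow> sends (config pr Vis al a b md u) = None"
  shows "nstep (config pr Vis al a b md) = (\<lambda>u. if u \<in> V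
    then upd (config pr Vis al a b md u) (if u \<in> nb v then Some m else None)
    else config pr Vis al a b md u)"
proof -
  have "u \<in> transmit (config pr Vis al a b md) \<longleftrightarrow> u = v" for u
    using assms unfolding transmit_def by (cases "u = v") auto
  then have "transmit (config pr Vis al a b md) = {v}" by blast
  then show ?thesis
    using assms(1-3) by (auto simp: nstep_def heard_def rc_single dec_enc config_def fun_eq_iff)
qed

lemma nstep_silent:
  assumes "\<And>u. u \<in> V \<Longrightarrow> sends (config pr Vis al a b md u) = None"
  shows "nstep (config pr Vis al a b md) = (\<lambda>u. if u \<in> V
    then upd (config pr Vis al a b md u) None else config pr Vis al a b md u)"
proof -
  have "transmit (config pr Vis al a b md) = {}"
    using assms by (auto simp: transmit_def)
  then show ?thesis
    by (auto simp: nstep_def heard_def)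
qed

text \<open>The holder requests a row under its own name, which nobody else answers, so own and
  supplied rows take the same two rounds.\<close>

lemma fetch_own:
  assumes "h \<in> V"
  shows "nstep (nstep (config pr Vis al a b (only h (Ask h)))) = (case a h of
      [] \<Rightarrow> config pr Vis al a b (only h (Out (Return (pr h) h)))
    | r # rs \<Rightarrow> config pr Vis al (a(h := rs)) b (only h (Pose h r)))"
proof -
  have "nstep (config pr Vis al a b (only h (Ask h))) = config pr Vis al a b (only h (Await h))"
    by (subst nstep_single[of h _ _ _ _ _ _ "Request h"])
      (use assms V_less in \<open>auto simp: config_def only_def fun_eq_iff split: list.splits\<close>)
  moreover have "nstep (config pr Vis al a b (only h (Await h))) = (case a h of
      [] \<Rightarrow> config pr Vis al a b (only h (Out (Return (pr h) h)))
    | r # rs \<Rightarrow> config pr Vis al (a(h := rs)) b (only h (Pose h r)))"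
    by (subst nstep_silent)
      (use assms in \<open>auto simp: config_def only_def fun_eq_iff split: list.splits\<close>)
  ultimately show ?thesis by simp
qed

lemma fetch_aux:
  assumes h: "h \<in> V" and hp: "hp \<in> nb h" and len: "\<And>r. r \<in> set (b hp) \<Longrightarrow> length r = K + 2"
  shows "nstep (nstep (config pr Vis al a b (only h (Ask hp)))) = (case b hp of
      [] \<Rightarrow> config pr Vis al a b (only h (Out (Return (pr h) h)))
    | r # rs \<Rightarrow> config pr Vis al a (b(hp := rs)) (only h (Pose hp r)))"
proof -
  have V: "hp \<in> V" "hp \<noteq> h" "h \<in> nb hp" using hp nbV nb_sym by auto
  have 1: "nstep (config pr Vis al a b (only h (Ask hp))) = (case b hp of
      [] \<Rightarrow> config pr Vis al a b (only h (Await hp))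
    | r # rs \<Rightarrow> config pr Vis al a (b(hp := rs)) ((only h (Await hp))(hp := Out (Word r))))"
    by (subst nstep_single[of h _ _ _ _ _ _ "Request hp"])
      (use h hp V V_less in \<open>auto simp: config_def only_def fun_eq_iff split: list.splits\<close>)
  show ?thesis
  proof (cases "b hp")
    case Nil
    have "nstep (config pr Vis al a b (only h (Await hp))) = config pr Vis al a b (only h (Out (Return (pr h) h)))"
      by (subst nstep_silent) (use h V in \<open>auto simp: config_def only_def fun_eq_iff\<close>)
    then show ?thesis using 1 Nil by simp
  next
    case (Cons r rs)
    have "nstep (config pr Vis al a (b(hp := rs)) ((only h (Await hp))(hp := Out (Word r))))
        = config pr Vis al a (b(hp := rs)) (only h (Pose hp r))"
      by (subst nstep_single[of hp _ _ _ _ _ _ "Word r"])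
        (use h hp V len Cons in \<open>auto simp: config_def only_def fun_eq_iff\<close>)
    then show ?thesis using 1 Cons by simp
  qed
qed

text \<open>The second round is the only kind with several transmitters. Bystanders ignore
  \<open>Contend\<close>, so only what \<open>h\<close> receives matters, and by
  \<open>rc_Some\<close> that is a genuine contender.\<close>

lemma query_round:
  fixes r Vis h al
  defines "al' \<equiv> (\<lambda>u. if u \<in> nb h - Vis then (hd r \<or> al u) \<and> survives (tl r) u else al u)"
  assumes h: "h \<in> V" and hp: "hp \<in> V" and len: "length r = K + 2"
  shows "nstep (nstep (config pr Vis al a b (only h (Pose hp r))))
    = config pr Vis al' a b (only h (case rc {u \<in> nb h - Vis. al' u} h of
        Some w \<Rightarrow> Out (Token w h) | None \<Rightarrow> Ask hp))"
proof -
  let ?Y = "{u \<in> nb h - Vis. al' u}"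
  let ?L = "config pr Vis al' a b (\<lambda>u. if u = h then Listen hp else if u \<in> ?Y then Out (Contend u) else Idle)"
  have YV: "?Y \<subseteq> V" using nbV by auto
  have 1: "nstep (config pr Vis al a b (only h (Pose hp r))) = ?L"
    by (subst nstep_single[of h _ _ _ _ _ _ "Query r"])
      (use h len nbV in \<open>auto simp: config_def only_def fun_eq_iff al'_def\<close>)
  have T: "transmit ?L = ?Y"
    using YV nb_irrefl[of h] by (auto simp: transmit_def config_def only_def)
  have H: "heard ?L u = map_option Contend (rc ?Y u)" if "u \<in> V" for u
  proof (cases "rc ?Y u")
    case (Some x)
    then have "x \<in> ?Y" using rc_Some(1)[OF _ YV that] by blast
    moreover have "x \<noteq> h" using \<open>x \<in> ?Y\<close> nb_irrefl by auto
    moreover have "x \<in> V" using \<open>x \<in> ?Y\<close> YV by blast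
    ultimately show ?thesis
      using Some V_less[of x] by (simp add: heard_def T) (simp add: config_def only_def unbin_bin)
  qed (simp add: heard_def T)
  have "nstep ?L = config pr Vis al' a b (only h (case rc ?Y h of Some w \<Rightarrow> Out (Token w h) | None \<Rightarrow> Ask hp))"
  proof
    fix u
    show "nstep ?L u
      = config pr Vis al' a b (only h (case rc ?Y h of Some w \<Rightarrow> Out (Token w h) | None \<Rightarrow> Ask hp)) u"
    proof (cases "u \<in> V")
      case True
      have "nstep ?L u = upd (?L u) (map_option Contend (rc ?Y u))"
        using True H by (simp add: nstep_def)
      then show ?thesis
        by (auto simp: config_def only_def split: option.splits)
    next
      case False
      then show ?thesis using h YV by (auto simp: nstep_def config_def only_def)
    qed
  qed
  then show ?thesis using 1 by simp
qed

text \<open>Induction on the unread rows: four rounds for each, and two in which the end of the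
  block is noticed. The marks \<open>al\<close> may be left over from earlier trials; every block
  but the one read stays intact for later elections.\<close>

lemma election:
  assumes "h \<in> V" "hp = h \<or> hp \<in> nb h" "(if hp = h then a h else b hp) = rs"
    and "\<And>r. r \<in> set rs \<Longrightarrow> length r = K + 2"
  shows "\<exists>n al' a' b'. n \<le> 4 * length rs + 2
    \<and> (nstep ^^ n) (config pr Vis al a b (only h (Ask hp))) = config pr Vis al' a' b' (only h
        (Out (case elect (\<lambda>Y. rc Y h) (nb h - Vis) {u \<in> nb h - Vis. al u} rs of
          Some w \<Rightarrow> Token w h | None \<Rightarrow> Return (pr h) h)))
    \<and> (\<forall>u. \<not> (hp = h \<and> u = h) \<longrightarrow> a' u = a u) \<and> (\<forall>u. \<not> (hp \<noteq> h \<and> u = hp) \<longrightarrow> b' u = b u)"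
  using assms(3,4)
proof (induction rs arbitrary: a b al)
  case Nil
  have "nstep (nstep (config pr Vis al a b (only h (Ask hp)))) = config pr Vis al a b (only h (Out (Return (pr h) h)))"
  proof (cases "hp = h")
    case True
    then show ?thesis using fetch_own[OF assms(1)] Nil by simp
  next
    case False
    then show ?thesis using fetch_aux[OF assms(1), of hp b] assms(2) Nil by simp
  qed
  then show ?case
    by (rule_tac x = 2 in exI, rule_tac x = al in exI, rule_tac x = a in exI, rule_tac x = b in exI)
      (simp add: numeral_2_eq_2)
next
  case (Cons r rs)
  define a1 where "a1 = (if hp = h then a(h := rs) else a)"
  define b1 where "b1 = (if hp = h then b else b(hp := rs))"
  define al1 where "al1 = (\<lambda>u. if u \<in> nb h - Vis then (hd r \<or> al u) \<and> survives (tl r) u else al u)"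
  define Y where "Y = {u \<in> nb h - Vis. al1 u}"
  have hpV: "hp \<in> V" using assms(1,2) nbV by auto
  have "nstep (nstep (config pr Vis al a b (only h (Ask hp)))) = config pr Vis al a1 b1 (only h (Pose hp r))"
  proof (cases "hp = h")
    case True
    then show ?thesis using fetch_own[OF assms(1)] Cons.prems by (simp add: a1_def b1_def)
  next
    case False
    then show ?thesis
      using fetch_aux[OF assms(1), of hp b] assms(2) Cons.prems by (simp add: a1_def b1_def)
  qed
  moreover have "nstep (nstep (config pr Vis al a1 b1 (only h (Pose hp r))))
      = config pr Vis al1 a1 b1 (only h (case rc Y h of Some w \<Rightarrow> Out (Token w h) | None \<Rightarrow> Ask hp))"
    unfolding al1_def Y_def by (rule query_round) (use assms(1) hpV Cons.prems in auto)
  ultimately have 4: "(nstep ^^ 4) (config pr Vis al a b (only h (Ask hp)))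
      = config pr Vis al1 a1 b1 (only h (case rc Y h of Some w \<Rightarrow> Out (Token w h) | None \<Rightarrow> Ask hp))"
    by (simp add: numeral_eq_Suc)
  have Y: "Y = {u \<in> (if hd r then nb h - Vis else {u \<in> nb h - Vis. al u}). survives (tl r) u}"
    by (auto simp: Y_def al1_def)
  show ?case
  proof (cases "rc Y h")
    case (Some w)
    then show ?thesis
      using 4 unfolding elect.simps Y[symmetric] Let_def
      by (rule_tac x = 4 in exI, rule_tac x = al1 in exI, rule_tac x = a1 in exI, rule_tac x = b1 in exI)
        (simp add: a1_def b1_def)
  next
    case None
    have "(if hp = h then a1 h else b1 hp) = rs" by (simp add: a1_def b1_def)
    from Cons.IH[of a1 b1 al1, OF this] Cons.prems(2) obtain n al' a' b' where
      n: "n \<le> 4 * length rs + 2"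
      and L: "(nstep ^^ n) (config pr Vis al1 a1 b1 (only h (Ask hp))) = config pr Vis al' a' b' (only h
        (Out (case elect (\<lambda>Y. rc Y h) (nb h - Vis) Y rs of
          Some w \<Rightarrow> Token w h | None \<Rightarrow> Return (pr h) h)))"
      and ab: "\<forall>u. \<not> (hp = h \<and> u = h) \<longrightarrow> a' u = a1 u" "\<forall>u. \<not> (hp \<noteq> h \<and> u = hp) \<longrightarrow> b' u = b1 u"
      unfolding Y_def by auto
    have "(nstep ^^ (n + 4)) (config pr Vis al a b (only h (Ask hp)))
        = (nstep ^^ n) (config pr Vis al1 a1 b1 (only h (Ask hp)))"
      using 4 None by (simp add: funpow_add)
    then show ?thesis
      using n L ab None unfolding elect.simps Y[symmetric] Let_def
      by (rule_tac x = "n + 4" in exI, rule_tac x = al' in exI, rule_tac x = a' in exI, rule_tac x = b' in exI)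
        (simp add: a1_def b1_def)
  qed
qed

lemma send_token:
  assumes "h \<in> V" "w \<in> nb h"
  shows "nstep (config pr Vis al a b (only h (Out (Token w h))))
    = config (pr(w := h)) (insert w Vis) al a b (only w (Ask w))"
proof -
  have "w \<in> V" "w \<noteq> h" using assms nbV by auto
  then show ?thesis
    by (subst nstep_single[of h _ _ _ _ _ _ "Token w h"])
      (use assms V_less in \<open>auto simp: config_def only_def fun_eq_iff\<close>)
qed

lemma return_token:
  assumes "h \<in> V" "p \<in> nb h"
  shows "nstep (config pr Vis al a b (only h (Out (Return p h)))) = config pr Vis al a b (only p (Ask h))"
proof -
  have "p \<in> V" "p \<noteq> h" using assms nbV by auto
  then show ?thesis
    by (subst nstep_single[of h _ _ _ _ _ _ "Return p h"])
      (use assms V_less in \<open>auto simp: config_def only_def fun_eq_iff\<close>)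
qed

lemma drop_token:
  assumes "h \<in> V"
  shows "nstep (config pr Vis al a b (only h (Out (Return 0 h)))) = config pr Vis al a b (\<lambda>_. Idle)"
proof -
  have "0 \<notin> V" using V_N by auto
  then show ?thesis
    by (subst nstep_single[of h _ _ _ _ _ _ "Return 0 h"])
      (use assms V_less in \<open>auto simp: config_def only_def fun_eq_iff\<close>)
qed

section \<open>Refinement of the tour by the protocol\<close>

text \<open>The source keeps the initial parent 0, which is nobody's name, so its final return message
  ends the protocol.\<close>

fun parents :: "(nat \<Rightarrow> nat) \<Rightarrow> nat list \<Rightarrow> bool" where
  "parents pr [] \<longleftrightarrow> True"
| "parents pr [x] \<longleftrightarrow> pr x = 0"
| "parents pr (x # y # s) \<longleftrightarrow> pr x = y \<and> parents pr (y # s)"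

lemma parents_upd: "w \<notin> set s \<Longrightarrow> parents (pr(w := h)) s = parents pr s"
  by (induction pr s rule: parents.induct) auto

text \<open>Stored rows are tied to blocks only while these are fresh; consumed lists and the marks
  \<open>al\<close> stay unspecified, as no later election depends on them.\<close>

definition refines :: "(nat \<times> bool \<Rightarrow> bool list) \<Rightarrow> tour \<Rightarrow> (nat \<Rightarrow> node) \<Rightarrow> bool" where
  "refines g st L \<longleftrightarrow> (case st of (Vis, s, hp) \<Rightarrow> \<exists>pr al a b.
     L = config pr Vis al a b (case s of [] \<Rightarrow> (\<lambda>_. Idle) | h # _ \<Rightarrow> only h (Ask hp)) \<and> parents pr s
     \<and> (\<forall>u\<in>V. \<forall>c. (u, c) \<in> fresh st \<longrightarrow> (if c then a u else b u) = seed (Suc K) t (g (u, c))))"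

lemma refinesI:
  assumes "L = config pr Vis al a b (case s of [] \<Rightarrow> (\<lambda>_. Idle) | h # _ \<Rightarrow> only h (Ask hp))"
    and "parents pr s"
    and "\<And>u c. u \<in> V \<Longrightarrow> (u, c) \<in> fresh (Vis, s, hp)
      \<Longrightarrow> (if c then a u else b u) = seed (Suc K) t (g (u, c))"
  shows "refines g (Vis, s, hp) L"
  unfolding refines_def prod.case
  by (rule exI[of _ pr], rule exI[of _ al], rule exI[of _ a], rule exI[of _ b]) (use assms in blast)

text \<open>The first row of a block is flagged and so discards marks left by earlier
  elections.\<close>

lemma elect_start: "elect rd X Y (seed (Suc W) n xs) = elect rd X {} (seed (Suc W) n xs)"
  by (cases n) (simp_all add: flag_def)

lemma refines_tstep:
  assumes inv: "tour_inv st" and ref: "refines g st L"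
    and len: "\<And>b. fst b \<in> V \<Longrightarrow> length (g b) = t * (Suc K * Suc K)"
  shows "\<exists>n \<le> 4 * (t * Suc K) + 3. refines g (tstep g st) ((nstep ^^ n) L)"
proof (cases st rule: block_read.cases)
  case (1 Vis hp)
  then show ?thesis using ref by (intro exI[of _ 0]) auto
next
  case (2 Vis h s hp)
  let ?b = "(hp, hp = h)"
  obtain pr al a b where L: "L = config pr Vis al a b (only h (Ask hp))" and pr: "parents pr (h # s)"
    and ab: "\<And>u c. u \<in> V \<Longrightarrow> (u, c) \<in> fresh st
      \<Longrightarrow> (if c then a u else b u) = seed (Suc K) t (g (u, c))"
    using ref 2 by (auto simp: refines_def)
  have h: "h \<in> V" "hp \<in> V" "hp = h \<or> hp \<in> nb h" and hV: "h \<in> Vis"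
    using inv 2 by auto
  let ?rs = "seed (Suc K) t (g ?b)"
  have rs: "(if hp = h then a h else b hp) = ?rs"
    using ab[of hp "hp = h"] h 2 by (auto simp: fresh_def)
  have E: "winner h (nb h - Vis) (g ?b) = elect (\<lambda>Y. rc Y h) (nb h - Vis) {} ?rs"
    using h by (simp add: winner_def)
  have "length r = K + 2" if "r \<in> set ?rs" for r
    using seed_row_length[OF _ that] len[of ?b] h by simp
  from election[of h hp a b ?rs pr Vis al, OF h(1) h(3) rs this]
  obtain n al' a' b' where n: "n \<le> 4 * (t * Suc K) + 2"
    and L': "(nstep ^^ n) L = config pr Vis al' a' b' (only h
        (Out (case winner h (nb h - Vis) (g ?b) of
          Some w \<Rightarrow> Token w h | None \<Rightarrow> Return (pr h) h)))"
    and a': "\<And>u. \<not> (hp = h \<and> u = h) \<Longrightarrow> a' u = a u"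
    and b': "\<And>u. \<not> (hp \<noteq> h \<and> u = hp) \<Longrightarrow> b' u = b u"
    unfolding L E length_seed elect_start[of _ _ "{u \<in> nb h - Vis. al u}"] by blast
  have fr: "fresh (tstep g st) \<subseteq> fresh st - {?b}"
    using fresh_tstep[OF inv, of g] 2 by auto
  have ab': "(if c then a' u else b' u) = seed (Suc K) t (g (u, c))"
    if "u \<in> V" "(u, c) \<in> fresh (tstep g st)" for u c
  proof -
    have "(u, c) \<in> fresh st" "(u, c) \<noteq> ?b" using fr that by blast+
    then show ?thesis using ab[of u c] a'[of u] b'[of u] that by (cases c) auto
  qed
  \<comment> \<open>The extra round hands the token to the winner or to the parent; at the source it
    goes to nobody.\<close>
  have S: "(nstep ^^ Suc n) L = nstep ((nstep ^^ n) L)" by simp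
  have "refines g (tstep g st) ((nstep ^^ Suc n) L)"
  proof (cases "winner h (nb h - Vis) (g ?b)")
    case None
    have tst: "tstep g st = (Vis, s, h)" using 2 None by simp
    show ?thesis
    proof (cases s)
      case Nil
      have "(nstep ^^ Suc n) L = config pr Vis al' a' b' (\<lambda>_. Idle)"
        unfolding S L' using None pr Nil drop_token[OF h(1)] by simp
      then show ?thesis unfolding tst
        by (intro refinesI[of _ pr Vis al' a' b']) (use ab' Nil tst in simp_all)
    next
      case (Cons p s')
      have p: "pr h = p" "parents pr (p # s')" using pr Cons by auto
      have "p \<in> nb h" using inv 2 Cons by auto
      then have "(nstep ^^ Suc n) L = config pr Vis al' a' b' (only p (Ask h))"
        unfolding S L' using None p return_token[OF h(1)] by simp
      then show ?thesis unfolding tst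
        by (intro refinesI[of _ pr Vis al' a' b']) (use ab' Cons p tst in simp_all)
    qed
  next
    case (Some w)
    have w: "w \<in> nb h - Vis" using winner_in[OF Diff_subset Some] .
    have tst: "tstep g st = (insert w Vis, w # h # s, w)" using 2 Some by simp
    have "(nstep ^^ Suc n) L = config (pr(w := h)) (insert w Vis) al' a' b' (only w (Ask w))"
      unfolding S L' using Some w send_token[OF h(1)] by simp
    moreover have "parents (pr(w := h)) (w # h # s)"
      using pr parents_upd[of w "h # s" pr h] inv 2 w by auto
    ultimately show ?thesis unfolding tst
      by (intro refinesI[of _ "pr(w := h)" "insert w Vis" al' a' b'])
        (use ab' tst in \<open>simp_all del: parents.simps\<close>)
  qed
  then show ?thesis using n by (intro exI[of _ "Suc n"]) auto
qed

lemma refines_tour: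
  assumes "refines g (tour g 0) L" "\<And>b. fst b \<in> V \<Longrightarrow> length (g b) = t * (Suc K * Suc K)"
  shows "\<exists>n \<le> k * (4 * (t * Suc K) + 3). refines g (tour g k) ((nstep ^^ n) L)"
proof (induction k)
  case 0
  then show ?case using assms(1) by (intro exI[of _ 0]) auto
next
  case (Suc k)
  then obtain n where n: "n \<le> k * (4 * (t * Suc K) + 3)" "refines g (tour g k) ((nstep ^^ n) L)"
    by blast
  from refines_tstep[OF tour_inv_tour n(2) assms(2)] obtain n' where
    "n' \<le> 4 * (t * Suc K) + 3" "refines g (tour g (Suc k)) ((nstep ^^ n') ((nstep ^^ n) L))"
    by auto
  then show ?case using n by (intro exI[of _ "n' + n"]) (auto simp: funpow_add)
qed

end

section \<open>Round complexity and failure probability\<close>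

definition name_bits :: "nat \<Rightarrow> nat" where
  "name_bits N = nat \<lceil>log 2 (real N + 1)\<rceil>"

lemma less_two_power_name_bits: "real N + 1 \<le> 2 ^ name_bits N"
proof -
  have "log 2 (real N + 1) \<le> real (name_bits N)" unfolding name_bits_def by linarith
  have "real N + 1 = 2 powr log 2 (real N + 1)" by simp
  also have "\<dots> \<le> 2 powr real (name_bits N)" by (rule powr_mono) (simp_all add: \<open>log 2 (real N + 1) \<le> real (name_bits N)\<close>)
  also have "\<dots> = 2 ^ name_bits N" by (simp add: powr_realpow)
  finally show ?thesis .
qed

lemma name_bits_le:
  assumes "N \<ge> 1"
  shows "1 \<le> log 2 (real N + 1)" "real (name_bits N) \<le> 2 * log 2 (real N + 1)"
    "real (Suc (name_bits N)) \<le> 3 * log 2 (real N + 1)"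
proof -
  show *: "1 \<le> log 2 (real N + 1)" using assms by (simp add: le_log_iff)
  have "real (name_bits N) \<le> log 2 (real N + 1) + 1" using * unfolding name_bits_def by linarith
  then show "real (name_bits N) \<le> 2 * log 2 (real N + 1)"
    "real (Suc (name_bits N)) \<le> 3 * log 2 (real N + 1)"
    using * by linarith+
qed

text \<open>States are coded as numbers to fit \<open>nat dalg\<close>. Every message carries the
  rumor, so waking up and learning the rumor coincide.\<close>

definition wireless_dfs :: "nat \<Rightarrow> nat dalg" where
  "wireless_dfs ct = \<lparr>
     a_init = (\<lambda>N D v s bits. to_nat (init (name_bits N) (ct * name_bits N) v s bits)),
     a_act = (\<lambda>x. map_option (\<lambda>m. (True, enc (width (from_nat x)) m)) (sends (from_nat x))),
     a_upd = (\<lambda>x r. to_nat (upd (from_nat x) (map_option (\<lambda>m. dec (width (from_nat x)) (snd m)) r))),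
     a_nbits = (\<lambda>N D. 2 * (ct * name_bits N * (Suc (name_bits N) * Suc (name_bits N))))\<rparr>"

lemma width_run: "v \<in> V \<Longrightarrow>
    width (from_nat (n_st (run S (wireless_dfs ct) N D V pos src bits n v))) = name_bits N"
proof (induction n)
  case 0
  then show ?case by (simp add: wireless_dfs_def init_def Let_def)
next
  case (Suc n)
  then show ?case by (simp add: step_def Let_def) (simp add: wireless_dfs_def)
qed

lemma msg_size_wireless_dfs:
  assumes "valid_network S N V pos src"
  shows "msg_size_ok S (wireless_dfs ct) 9 N V pos src"
  unfolding msg_size_ok_def
proof (intro allI ballI impI, elim conjE)
  fix bits n v b ctl
  let ?c = "run S (wireless_dfs ct) N (max_degree S V pos) V pos src bits n"
  assume v: "v \<in> V" and act: "a_act (wireless_dfs ct) (n_st (?c v)) = Some (b, ctl)"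
  have "N \<ge> 1" using assms by (auto simp: valid_network_def)
  have "width (from_nat (n_st (?c v))) = name_bits N" by (rule width_run[OF v])
  then obtain m where "ctl = enc (name_bits N) m"
    using act by (auto simp: wireless_dfs_def)
  then have "length ctl \<le> 2 * name_bits N + 5" using length_enc by simp
  then have "real (length ctl) \<le> 2 * real (name_bits N) + 5" by linarith
  \<comment> \<open>With \<open>l = log 2 (N + 1) >= 1\<close>, the length is at most
    \<open>2 * (2 * l) + 5 * l\<close>.\<close>
  then show "real (length ctl) \<le> 9 * log 2 (real N + 1)"
    using name_bits_le[OF \<open>N \<ge> 1\<close>] by linarith
qed

section \<open>Coupling with executions of the model\<close>

lemma sends_Idle: "mode c = Idle \<Longrightarrow> sends c = None"
  by (cases c) auto

lemma upd_Idle_None: "mode c = Idle \<Longrightarrow> upd c None = c"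
  by (cases c) auto

context network
begin

text \<open>Nodes that are asleep sit in a state that \<open>upd\<close> leaves alone in silence, so the awake flag
  need not be tracked by \<open>nstep\<close>.\<close>

definition coupled :: "(nat \<Rightarrow> nat nstate) \<Rightarrow> (nat \<Rightarrow> node) \<Rightarrow> bool" where
  "coupled c L \<longleftrightarrow> (\<forall>v\<in>V. n_st (c v) = to_nat (L v) \<and> (n_awake (c v) \<longrightarrow> n_knows (c v))
     \<and> (\<not> n_awake (c v) \<longrightarrow> mode (L v) = Idle \<and> \<not> visited (L v)))"

text \<open>A sleeping node is idle and hence silent, so both systems have the same transmitters;
  every transmitter is awake and knows the rumor, so a node that wakes learns it.\<close>

lemma coupled_step:
  assumes c: "coupled c L"
  shows "coupled (step S (wireless_dfs ct) V pos c) (nstep L)"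
proof -
  let ?A = "wireless_dfs ct"
  have act: "a_act ?A (n_st (c v)) = map_option (\<lambda>m. (True, enc (width (L v)) m)) (sends (L v))"
    if "v \<in> V" for v
    using c that by (simp add: coupled_def wireless_dfs_def)
  have T: "transmitters ?A V c = transmit L"
  proof (rule set_eqI)
    fix v
    have "v \<in> V \<Longrightarrow> sends (L v) \<noteq> None \<Longrightarrow> n_awake (c v)"
      using c sends_Idle by (auto simp: coupled_def)
    then show "v \<in> transmitters ?A V c \<longleftrightarrow> v \<in> transmit L"
      using act[of v] by (cases "sends (L v)") (auto simp: transmitters_def transmit_def)
  qed
  have TV: "transmit L \<subseteq> V" by (auto simp: transmit_def)
  have out: "out_msg ?A (c x) = (True, enc (width (L x)) (the (sends (L x))))"
    if x: "x \<in> transmit L" for x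
  proof -
    obtain m where m: "sends (L x) = Some m" "x \<in> V" using x by (auto simp: transmit_def)
    then have "n_awake (c x)" using c sends_Idle by (fastforce simp: coupled_def)
    then have "n_knows (c x)" using c m by (auto simp: coupled_def)
    then show ?thesis using m by (simp add: out_msg_def act)
  qed
  have rec: "received S ?A V pos c u
      = map_option (\<lambda>x. (True, enc (width (L x)) (the (sends (L x))))) (rc (transmit L) u)"
    if u: "u \<in> V" for u
  proof (cases "rc (transmit L) u")
    case None
    then show ?thesis by (auto simp: received_def T reception_def split: if_splits)
  next
    case (Some x)
    then have "x \<in> transmit L" using rc_Some TV u by blast
    moreover have "x = (SOME v. sinr_receives S pos (transmit L) v u)"
      "\<exists>v. sinr_receives S pos (transmit L) v u"
      using Some by (auto simp: reception_def split: if_splits)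
    ultimately show ?thesis using Some out[of x] by (simp add: received_def T Let_def)
  qed
  have upd: "a_upd ?A (n_st (c u)) (map_option (\<lambda>x. (True, enc (width (L x)) (the (sends (L x))))) (rc (transmit L) u))
      = to_nat (nstep L u)" if "u \<in> V" for u
    using c that
    by (simp add: coupled_def wireless_dfs_def nstep_def heard_def option.map_comp comp_def)
  show ?thesis
    unfolding coupled_def
  proof (intro ballI)
    fix u assume u: "u \<in> V"
    have cu: "n_st (c u) = to_nat (L u)" "n_awake (c u) \<longrightarrow> n_knows (c u)"
      "\<not> n_awake (c u) \<longrightarrow> mode (L u) = Idle \<and> \<not> visited (L u)"
      using c u by (auto simp: coupled_def)
    show "n_st (step S ?A V pos c u) = to_nat (nstep L u)
      \<and> (n_awake (step S ?A V pos c u) \<longrightarrow> n_knows (step S ?A V pos c u))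
      \<and> (\<not> n_awake (step S ?A V pos c u) \<longrightarrow> mode (nstep L u) = Idle \<and> \<not> visited (nstep L u))"
    proof (cases "u \<in> transmit L")
      case True
      then have awake: "n_awake (c u)" using cu(3) sends_Idle by (auto simp: transmit_def)
      have "rc (transmit L) u = None" using rc_Some(2)[OF _ TV u] True by fastforce
      then have "a_upd ?A (n_st (c u)) None = to_nat (nstep L u)" using upd[OF u] by simp
      then show ?thesis using True u awake cu(2) by (simp add: step_def T)
    next
      case False
      show ?thesis
      proof (cases "n_awake (c u) \<or> rc (transmit L) u \<noteq> None")
        case True
        then show ?thesis
          using False u cu upd[OF u] by (auto simp: step_def T rec Let_def)
      next
        case asleep: False
        then have "nstep L u = L u"
          using cu(3) u by (simp add: nstep_def heard_def upd_Idle_None)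
        then show ?thesis using False u cu asleep by (simp add: step_def T rec Let_def)
      qed
    qed
  qed
qed

text \<open>A complete tour leaves every node visited; \<open>coupled\<close> turns visited into
  awake, and awake into knowing the rumor.\<close>

lemma broadcast_done_tour:
  assumes K_def: "K = name_bits N" and t_def: "t = ct * name_bits N"
    and bits: "bits \<in> bit_space M V" and M: "M = t * (Suc K * Suc K)"
    and ok: "\<And>k. \<not> fails (block M bits) (tour (block M bits) k)"
  shows "\<exists>n \<le> (2 * card V - 1) * (4 * (t * Suc K) + 3).
    broadcast_done S (wireless_dfs ct) N D V pos src bits n"
proof -
  let ?g = "block M bits"
  define L0 where "L0 = (\<lambda>v. init K t v (v = src) (bits v))"
  have cpl: "coupled (run S (wireless_dfs ct) N D V pos src bits n) ((nstep ^^ n) L0)" for n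
  proof (induction n)
    case 0
    then show ?case
      by (auto simp: coupled_def L0_def wireless_dfs_def K_def t_def init_def Let_def)
  next
    case (Suc n)
    then show ?case using coupled_step by simp
  qed
  have "refines ?g (tour ?g 0) L0"
    unfolding tour.simps
    by (rule refinesI[of _ "\<lambda>_. 0" _ "\<lambda>_. False" "\<lambda>u. seed (Suc K) t (take M (bits u))"
          "\<lambda>u. seed (Suc K) t (drop M (bits u))"])
      (auto simp: L0_def init_def Let_def M config_def only_def block_def)
  moreover have "length (?g b) = t * (Suc K * Suc K)" if "fst b \<in> V" for b
    using block_strs[OF bits that] by (simp add: bit_strings_def M)
  ultimately obtain n where n: "n \<le> (2 * card V - 1) * (4 * (t * Suc K) + 3)"
    and r: "refines ?g (tour ?g (2 * card V - 1)) ((nstep ^^ n) L0)"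
    using refines_tour[of ?g L0 "2 * card V - 1"] by auto
  have "visited ((nstep ^^ n) L0 v)" if "v \<in> V" for v
    using r tour_complete[of ?g] ok that by (auto simp: refines_def config_def)
  then have "broadcast_done S (wireless_dfs ct) N D V pos src bits n"
    using cpl[of n] by (auto simp: broadcast_done_def coupled_def)
  then show ?thesis using n by blast
qed

lemma card_winner_None:
  assumes "X \<subseteq> nb h" "X \<noteq> {}"
  shows "real (card {x \<in> bit_strings (t * (Suc K * Suc K)). winner h X x = None})
    \<le> (13 / 16) ^ t * 2 ^ (t * (Suc K * Suc K))"
proof -
  have h: "h \<in> V" using assms by (auto simp: nb_def comm_adj_def)
  have X: "X \<subseteq> V" using assms nbV by blast
  have "stuck X (Suc K) t x" if "winner h X x = None" for x
  proof (rule elect_seed_None[where Y = "{}" and rc = "\<lambda>Y. rc Y h"])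
    fix u assume "u \<in> X"
    then have "h \<in> nb u" using assms nb_sym by blast
    then show "rc {u} h \<noteq> None" using receives_single by (auto simp: reception_def)
  qed (use that h in \<open>auto simp: winner_def\<close>)
  then have "card {x \<in> bit_strings (t * (Suc K * Suc K)). winner h X x = None}
      \<le> card {x \<in> bit_strings (t * (Suc K * Suc K)). stuck X (Suc K) t x}"
    by (intro card_mono) auto
  also have "real \<dots> \<le> (13 / 16) ^ t * 2 ^ (t * (Suc K * Suc K))"
    by (rule card_stuck_le) (use X finV finite_subset V_less assms in auto)
  finally show ?thesis by simp
qed

lemma prob_broadcast_done:
  assumes K_def: "K = name_bits N" and t_def: "t = ct * name_bits N"
  shows "measure_pmf.prob (random_bits (wireless_dfs ct) N D V)
      {bits. \<exists>n \<le> (2 * card V - 1) * (4 * (t * Suc K) + 3).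
        broadcast_done S (wireless_dfs ct) N D V pos src bits n}
    \<ge> 1 - 2 * real (card V) * (13 / 16) ^ t"
proof -
  define M where "M = t * (Suc K * Suc K)"
  let ?O = "bit_space M V"
  let ?F = "{bits. \<exists>k. fails (block M bits) (tour (block M bits) k)}"
  let ?G = "{bits. \<exists>n \<le> (2 * card V - 1) * (4 * (t * Suc K) + 3).
        broadcast_done S (wireless_dfs ct) N D V pos src bits n}"
  have fin: "finite ?O" by (rule finite_bit_space[OF finV])
  have ne: "?O \<noteq> {}"
  proof -
    have "(\<lambda>v. if v \<in> V then replicate (2 * M) False else []) \<in> ?O"
      by (auto simp: bit_space_def PiE_dflt_def bit_strings_def)
    then show ?thesis by blast
  qed
  have ne_strings: "bit_strings (2 * M) \<noteq> {}"
    using card_bit_strings[of "2 * M"] by (metis card.empty power_not_zero zero_neq_numeral)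
  have "{xs. length xs = a_nbits (wireless_dfs ct) N D} = bit_strings (2 * M)"
    by (simp add: wireless_dfs_def K_def t_def M_def bit_strings_def)
  then have "random_bits (wireless_dfs ct) N D V = pmf_of_set ?O"
    unfolding random_bits_def bit_space_def
    using Pi_pmf_of_set[of V "\<lambda>_. bit_strings (2 * M)" "[]"] finV ne_strings by simp
  moreover have "real (card (?O \<inter> ?F)) \<le> 2 * real (card V) * (13 / 16) ^ t * real (card ?O)"
    by (rule card_fails_le) (use card_winner_None M_def in auto)
  moreover have "card ?O \<le> card (?O \<inter> ?G) + card (?O \<inter> ?F)"
  proof -
    have "?O \<subseteq> (?O \<inter> ?G) \<union> (?O \<inter> ?F)"
      using broadcast_done_tour[OF K_def t_def _ M_def] by blast
    then have "card ?O \<le> card ((?O \<inter> ?G) \<union> (?O \<inter> ?F))" by (intro card_mono) (use fin in auto)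
    also have "\<dots> \<le> card (?O \<inter> ?G) + card (?O \<inter> ?F)" by (rule card_Un_le)
    finally show ?thesis .
  qed
  ultimately have "random_bits (wireless_dfs ct) N D V = pmf_of_set ?O"
    "(1 - 2 * real (card V) * (13 / 16) ^ t) * real (card ?O) \<le> real (card (?O \<inter> ?G))"
    by (auto simp: algebra_simps)
  moreover have "card ?O > 0" using fin ne by (auto simp: card_gt_0_iff)
  ultimately show ?thesis
    by (simp add: measure_pmf_of_set[OF ne fin] pos_le_divide_eq)
qed

end

text \<open>Since \<open>(13/16)^4 <= 1/2\<close>, the \<open>4 * m * name_bits N\<close> trials
  fail with probability at most \<open>(N + 1)^(-m)\<close>. Of the \<open>d + 2\<close> powers
  available, one pays for the \<open>n\<close> of the union bound and one for its factor 2, as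
  \<open>1 / (N + 1) <= 1/2\<close>.\<close>

lemma failure_bound:
  assumes d: "d \<ge> 1" and m: "real m \<ge> d + 2" and n: "1 \<le> n" "n \<le> N"
  shows "2 * real n * (13 / 16) ^ (4 * m * name_bits N) \<le> real n powr (- d)"
proof -
  let ?K = "name_bits N" and ?x = "real N + 1"
  have "(13 / 16 :: real) ^ (4 * m * ?K) = ((13 / 16) ^ 4) ^ (m * ?K)"
    by (simp only: power_mult[symmetric] mult.assoc)
  also have "\<dots> \<le> (1 / 2) ^ (m * ?K)"
    by (intro power_mono) (auto simp: power_divide)
  also have "\<dots> = (1 / 2 ^ ?K) ^ m"
    by (simp add: power_one_over power_mult mult.commute[of m])
  also have "\<dots> \<le> (1 / ?x) ^ m"
    using less_two_power_name_bits[of N] by (intro power_mono) (auto intro!: divide_left_mono)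
  also have "\<dots> = ?x powr (- real m)"
    by (simp add: powr_minus powr_realpow power_inverse divide_inverse)
  also have "\<dots> \<le> ?x powr (- d + - 1 + - 1)"
    using m by (intro powr_mono) auto
  also have "\<dots> = ?x powr (- d) * (1 / ?x) * (1 / ?x)"
    by (simp only: powr_add) (simp add: powr_minus_divide)
  also have "\<dots> \<le> real n powr (- d) * (1 / real n) * (1 / 2)"
    using n d by (intro mult_mono powr_mono2') (auto intro!: divide_left_mono)
  finally have "2 * real n * (13 / 16) ^ (4 * m * ?K)
      \<le> 2 * real n * (real n powr (- d) * (1 / real n) * (1 / 2))"
    by (intro mult_left_mono) auto
  also have "\<dots> = real n powr (- d)" using n by simp
  finally show ?thesis .
qed

theorem theorem1:
  fixes S :: sinr
  assumes "sinr_ok S"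
  shows "\<forall>d::real. d \<ge> 1 \<longrightarrow>
    (\<exists>(A :: nat dalg) (c::real) (cb::real) (cm::real).
       (\<forall>N D. real (a_nbits A N D) \<le> cb * (log 2 (real N + 1)) ^ 3) \<and>
       (\<forall>N V pos src. valid_network S N V pos src \<longrightarrow>
          msg_size_ok S A cm N V pos src \<and>
          measure_pmf.prob (random_bits A N (max_degree S V pos) V)
            {bits. \<exists>t. real t \<le> c * real (card V) * (log 2 (real N + 1)) ^ 2 \<and>
                       broadcast_done S A N (max_degree S V pos) V pos src bits t}
          \<ge> 1 - real (card V) powr (- d)))"
proof (intro allI impI)
  fix d :: real assume d: "d \<ge> 1"
  define m where "m = nat \<lceil>d + 2\<rceil>"
  have m: "real m \<ge> d + 2" unfolding m_def by linarith
  define ct where "ct = 4 * m"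
  let ?A = "wireless_dfs ct"
  \<comment> \<open>\<open>36 = 2 * 2 * 3 * 3\<close>: two blocks, a factor 2 from
    \<open>name_bits N\<close> and 3 from each \<open>Suc (name_bits N)\<close>. For
    \<open>N = 0\<close> both sides vanish.\<close>
  have nbits: "real (a_nbits ?A N D) \<le> real (36 * ct) * (log 2 (real N + 1)) ^ 3" for N D
  proof (cases "N \<ge> 1")
    case False
    then show ?thesis by (simp add: wireless_dfs_def name_bits_def)
  next
    case True
    let ?l = "log 2 (real N + 1)"
    note nb = name_bits_le[OF True]
    have "real (name_bits N) * (real (Suc (name_bits N)) * real (Suc (name_bits N)))
        \<le> (2 * ?l) * ((3 * ?l) * (3 * ?l))"
      using nb by (intro mult_mono) auto
    then have "2 * real ct * (real (name_bits N) * (real (Suc (name_bits N)) * real (Suc (name_bits N))))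
        \<le> 2 * real ct * ((2 * ?l) * ((3 * ?l) * (3 * ?l)))"
      by (intro mult_left_mono) auto
    moreover have "real (a_nbits ?A N D)
        = 2 * real ct * (real (name_bits N) * (real (Suc (name_bits N)) * real (Suc (name_bits N))))"
      by (simp only: wireless_dfs_def dalg.simps of_nat_mult of_nat_numeral mult.assoc)
    moreover have "2 * real ct * ((2 * ?l) * ((3 * ?l) * (3 * ?l))) = real (36 * ct) * ?l ^ 3"
      by (simp add: power3_eq_cube)
    ultimately show ?thesis by linarith
  qed
  have main: "measure_pmf.prob (random_bits ?A N (max_degree S V pos) V)
      {bits. \<exists>t. real t \<le> real (48 * ct + 6) * real (card V) * (log 2 (real N + 1)) ^ 2 \<and>
             broadcast_done S ?A N (max_degree S V pos) V pos src bits t}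
      \<ge> 1 - real (card V) powr (- d)"
    if valid: "valid_network S N V pos src" for N V pos src
  proof -
    let ?l = "log 2 (real N + 1)" and ?K = "name_bits N"
    have V: "V \<subseteq> {1..N}" "src \<in> V" using valid by (auto simp: valid_network_def)
    then have N: "N \<ge> 1" by auto
    have fin: "finite V" using V(1) finite_subset by blast
    have n: "1 \<le> card V" "card V \<le> N"
      using V fin card_mono[OF _ V(1)] by (auto simp: Suc_le_eq card_gt_0_iff)
    interpret network S N V pos src ?K "ct * ?K"
    proof
      have "real N < 2 ^ ?K" using less_two_power_name_bits[of N] by linarith
      then show "N < 2 ^ ?K" by (metis of_nat_less_iff of_nat_numeral of_nat_power)
    qed (fact assms valid)+
    \<comment> \<open>\<open>48 = 2 * 4 * 2 * 3\<close> comes from the rows and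
      \<open>6 = 2 * 3\<close> from the three extra rounds per election, absorbed by
      \<open>1 <= ?l * ?l\<close>.\<close>
    have time: "real i \<le> real (48 * ct + 6) * real (card V) * ?l ^ 2"
      if "i \<le> (2 * card V - 1) * (4 * (ct * ?K * Suc ?K) + 3)" for i
    proof -
      note nb = name_bits_le[OF N]
      have "i \<le> (2 * card V) * (4 * (ct * ?K * Suc ?K) + 3)"
        using that by (meson diff_le_self le_trans mult_le_mono1)
      then have "real i \<le> real ((2 * card V) * (4 * (ct * ?K * Suc ?K) + 3))" by linarith
      also have "\<dots> = 2 * real (card V) * (4 * real ct * (real ?K * real (Suc ?K)) + 3)"
        by (simp add: algebra_simps)
      also have "\<dots> \<le> 2 * real (card V) * (4 * real ct * ((2 * ?l) * (3 * ?l)) + 3 * (?l * ?l))"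
      proof (intro mult_left_mono add_mono)
        show "real ?K * real (Suc ?K) \<le> (2 * ?l) * (3 * ?l)"
          using nb by (intro mult_mono) auto
        have "1 * 1 \<le> ?l * ?l" using nb by (intro mult_mono) auto
        then show "3 \<le> 3 * (?l * ?l)" by simp
      qed auto
      also have "\<dots> = real (48 * ct + 6) * real (card V) * ?l ^ 2"
        by (simp add: power2_eq_square algebra_simps)
      finally show ?thesis .
    qed
    have "1 - real (card V) powr (- d) \<le> 1 - 2 * real (card V) * (13 / 16) ^ (ct * ?K)"
      using failure_bound[OF d m n] unfolding ct_def by linarith
    also have "\<dots> \<le> measure_pmf.prob (random_bits ?A N (max_degree S V pos) V)
      {bits. \<exists>i \<le> (2 * card V - 1) * (4 * (ct * ?K * Suc ?K) + 3).
        broadcast_done S ?A N (max_degree S V pos) V pos src bits i}"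
      by (rule prob_broadcast_done) simp_all
    also have "\<dots> \<le> measure_pmf.prob (random_bits ?A N (max_degree S V pos) V)
      {bits. \<exists>t. real t \<le> real (48 * ct + 6) * real (card V) * ?l ^ 2 \<and>
             broadcast_done S ?A N (max_degree S V pos) V pos src bits t}"
      using time by (intro measure_pmf.finite_measure_mono) auto
    finally show ?thesis .
  qed
  show "\<exists>(A :: nat dalg) (c::real) (cb::real) (cm::real).
       (\<forall>N D. real (a_nbits A N D) \<le> cb * (log 2 (real N + 1)) ^ 3) \<and>
       (\<forall>N V pos src. valid_network S N V pos src \<longrightarrow>
          msg_size_ok S A cm N V pos src \<and>
          measure_pmf.prob (random_bits A N (max_degree S V pos) V)
            {bits. \<exists>t. real t \<le> c * real (card V) * (log 2 (real N + 1)) ^ 2 \<and>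
                       broadcast_done S A N (max_degree S V pos) V pos src bits t}
          \<ge> 1 - real (card V) powr (- d))"
    by (rule exI[of _ ?A], rule exI[of _ "real (48 * ct + 6)"], rule exI[of _ "real (36 * ct)"],
        rule exI[of _ 9]) (use nbits main msg_size_wireless_dfs in blast)
qed

end
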